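(* Let $n\ge3$, let $L$ be a (properly) Lorentz-Finsler metric on $A$, and let $\mathrm{N}$ be any homogeneous nonlinear connection on $A$ which extends smoothly to $\overline A$ (not necessarily related to $L$), with Ricci scalar $\mathrm{Ric}$. If $$(n+2)\,\mathrm{Ric}-L\,g^{ab}\,\mathrm{Ric}_{\cdot a\cdot b}=0\quad\text{on }A,$$ then $\mathrm{Ric}=0$.
   Context: $M$ is a connected smooth manifold of dimension $n$, $\pi:TM\to M$ the projection. Charts $(x^i)$ of $M$ induce charts $(x^i,y^i)$ of $TM$; $\partial_i=\partial/\partial x^i$, $\dot\partial_i=\partial/\partial y^i$; repeated indices are summed; a subscript $\cdot i$ denotes $\dot\partial_i$. $A\subseteq TM\setminus\mathbf{0}$ is open and conic ($\lambda v\in A$ for $v\in A$, $\lambda>0$) with $\pi(A)=M$; $A_p=A\cap T_pM$; $\overline A$ is the closure of $A$ in $TM\setminus\mathbf 0$, $\partial A=\overline A\setminus A$. A homogeneous nonlinear connection $\mathrm{N}$ on $A$ is given in each chart by smooth functions $\mathrm{N}_i^k(x,y)$, positively $1$-homogeneous in $y$, transforming by $\bar{\mathrm{N}}_i^k=\frac{\partial\bar x^k}{\partial x^c}\frac{\partial^2x^c}{\partial\bar x^i\partial\bar x^b}\bar y^b+\frac{\partial\bar x^k}{\partial x^c}\frac{\partial x^a}{\partial\bar x^i}\mathrm{N}_a^c$. With $\delta_i=\partial_i-\mathrm{N}_i^a\dot\partial_a$, its curvature is $\mathcal{R}_{ij}^k=\delta_j\mathrm{N}_i^k-\delta_i\mathrm{N}_j^k$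 and its Ricci scalar is the $2$-homogeneous function $\mathrm{Ric}=y^b\mathcal{R}_{ba}^a$ on $A$. A pseudo-Finsler metric on $A$ is a smooth positively $2$-homogeneous $L:A\to\mathbb{R}$ with $g_{ij}=\frac12L_{\cdot i\cdot j}$ non-degenerate everywhere. It is proper if (i) each $A_p$ is connected and $L>0$ on $A$, and (ii) $L$ extends smoothly to $\overline A$ with $L=0$ and $g$ non-degenerate on $\partial A$. It is (properly) Lorentz-Finsler if it is proper and $g$ has signature $(+,-,\dots,-)$. *)

theory Defs
  imports "HOL-Analysis.Analysis"
begin

section \<open>Smooth maps and partial derivatives\<close>

text \<open>Both notions are meant for open \<open>S\<close> only. \<open>Ck_on k S f\<close> says that \<open>f\<close> is of class \<open>C\<^sup>k\<close> on \<open>S\<close>.\<close>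

fun Ck_on :: "nat \<Rightarrow> 'a::real_normed_vector set \<Rightarrow> ('a \<Rightarrow> 'b::real_normed_vector) \<Rightarrow> bool" where
  "Ck_on 0 S f \<longleftrightarrow> continuous_on S f"
| "Ck_on (Suc k) S f \<longleftrightarrow>
     (\<forall>x\<in>S. f differentiable (at x)) \<and> (\<forall>v. Ck_on k S (\<lambda>x. frechet_derivative f (at x) v))"

definition smooth_on :: "'a::real_normed_vector set \<Rightarrow> ('a \<Rightarrow> 'b::real_normed_vector) \<Rightarrow> bool" where
  "smooth_on S f \<longleftrightarrow> (\<forall>k. Ck_on k S f)"

definition pderiv_at :: "'n::finite \<Rightarrow> (real^'n \<Rightarrow> real) \<Rightarrow> real^'n \<Rightarrow> real" where
  "pderiv_at i f x = frechet_derivative f (at x) (axis i 1)"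

text \<open>Functions on a chart of the tangent bundle have arguments \<open>(x, y)\<close>; \<open>dx i\<close> and \<open>dy i\<close> are
  the derivatives with respect to \<open>x\<^sup>i\<close> and \<open>y\<^sup>i\<close>.\<close>

definition dx :: "'n::finite \<Rightarrow> ((real^'n) \<times> (real^'n) \<Rightarrow> real) \<Rightarrow> (real^'n) \<times> (real^'n) \<Rightarrow> real" where
  "dx i f z = frechet_derivative f (at z) (axis i 1, 0)"

definition dy :: "'n::finite \<Rightarrow> ((real^'n) \<times> (real^'n) \<Rightarrow> real) \<Rightarrow> (real^'n) \<times> (real^'n) \<Rightarrow> real" where
  "dy i f z = frechet_derivative f (at z) (0, axis i 1)"


section \<open>Smooth manifolds\<close>

text \<open>A chart is a pair \<open>(U, \<phi>)\<close>; the values of \<open>\<phi>\<close> outside \<open>U\<close> are irrelevant.\<close>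

type_synonym ('m, 'n) chart = "'m set \<times> ('m \<Rightarrow> real^'n)"

definition is_chart :: "'m topology \<Rightarrow> ('m, 'n::finite) chart \<Rightarrow> bool" where
  "is_chart M c \<longleftrightarrow>
     openin M (fst c) \<and> open (snd c ` fst c) \<and>
     homeomorphic_map (subtopology M (fst c)) (top_of_set (snd c ` fst c)) (snd c)"

definition transition :: "('m, 'n::finite) chart \<Rightarrow> ('m, 'n) chart \<Rightarrow> real^'n \<Rightarrow> real^'n" where
  "transition c d = snd d \<circ> inv_into (fst c) (snd c)"

definition compatible :: "('m, 'n::finite) chart \<Rightarrow> ('m, 'n) chart \<Rightarrow> bool" where
  "compatible c d \<longleftrightarrow>
     smooth_on (snd c ` (fst c \<inter> fst d)) (transition c d) \<and>
     smooth_on (snd d ` (fst c \<inter> fst d)) (transition d c)"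

definition smooth_atlas :: "'m topology \<Rightarrow> ('m, 'n::finite) chart set \<Rightarrow> bool" where
  "smooth_atlas M \<C> \<longleftrightarrow>
     (\<forall>c\<in>\<C>. is_chart M c) \<and> (\<Union>c\<in>\<C>. fst c) = topspace M \<and>
     (\<forall>c\<in>\<C>. \<forall>d\<in>\<C>. compatible c d)"

text \<open>The dimension is \<open>CARD('n)\<close>; the smooth structure \<open>\<C>\<close> is a maximal atlas.\<close>

definition smooth_manifold :: "'m topology \<Rightarrow> ('m, 'n::finite) chart set \<Rightarrow> bool" where
  "smooth_manifold M \<C> \<longleftrightarrow>
     Hausdorff_space M \<and> second_countable M \<and> smooth_atlas M \<C> \<and>
     (\<forall>c. is_chart M c \<and> (\<forall>d\<in>\<C>. compatible c d) \<longrightarrow> c \<in> \<C>)"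


section \<open>The tangent bundle\<close>

text \<open>A tangent vector at \<open>p\<close> is a pair \<open>(p, w)\<close>, where \<open>w\<close> assigns to each chart around \<open>p\<close> the
  components of the vector in that chart, subject to the usual transformation law. For charts not
  around \<open>p\<close> we normalise \<open>w\<close> to be \<open>0\<close>, so that equality of pairs is equality of vectors.\<close>

type_synonym ('m, 'n) tvec = "'m \<times> (('m, 'n) chart \<Rightarrow> real^'n)"

definition charts_at :: "('m, 'n::finite) chart set \<Rightarrow> 'm \<Rightarrow> ('m, 'n) chart set" where
  "charts_at \<C> p = {c \<in> \<C>. p \<in> fst c}"

definition tangent_bundle :: "'m topology \<Rightarrow> ('m, 'n::finite) chart set \<Rightarrow> ('m, 'n) tvec set" where
  "tangent_bundle M \<C> = {(p, w). p \<in> topspace M \<and>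
     (\<forall>c. c \<notin> charts_at \<C> p \<longrightarrow> w c = 0) \<and>
     (\<forall>c\<in>charts_at \<C> p. \<forall>d\<in>charts_at \<C> p.
        w d = frechet_derivative (transition c d) (at (snd c p)) (w c))}"

definition tscale :: "real \<Rightarrow> ('m, 'n::finite) tvec \<Rightarrow> ('m, 'n) tvec" where
  "tscale t v = (fst v, \<lambda>c. t *\<^sub>R snd v c)"

definition slit_bundle :: "'m topology \<Rightarrow> ('m, 'n::finite) chart set \<Rightarrow> ('m, 'n) tvec set" where
  "slit_bundle M \<C> = {v \<in> tangent_bundle M \<C>. snd v \<noteq> (\<lambda>_. 0)}"

text \<open>The part of a set of tangent vectors lying over the domain of \<open>c\<close>, and the induced
  coordinates \<open>(x, y)\<close> there.\<close>

definition over :: "('m, 'n::finite) chart \<Rightarrow> ('m, 'n) tvec set \<Rightarrow> ('m, 'n) tvec set" where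
  "over c S = {v \<in> S. fst v \<in> fst c}"

definition coords :: "('m, 'n::finite) chart \<Rightarrow> ('m, 'n) tvec \<Rightarrow> (real^'n) \<times> (real^'n)" where
  "coords c v = (snd c (fst v), snd v c)"

definition coord_set :: "('m, 'n::finite) chart \<Rightarrow> ('m, 'n) tvec set \<Rightarrow> ((real^'n) \<times> (real^'n)) set" where
  "coord_set c S = coords c ` over c S"

definition coord_rep :: "'m topology \<Rightarrow> ('m, 'n::finite) chart set \<Rightarrow> ('m, 'n) chart
    \<Rightarrow> (('m, 'n) tvec \<Rightarrow> real) \<Rightarrow> (real^'n) \<times> (real^'n) \<Rightarrow> real" where
  "coord_rep M \<C> c F = F \<circ> inv_into (over c (tangent_bundle M \<C>)) (coords c)"

text \<open>The topology of \<open>TM\<close> has the preimages of open sets under induced charts as a subbasis.\<close>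

definition tangent_topology :: "'m topology \<Rightarrow> ('m, 'n::finite) chart set \<Rightarrow> ('m, 'n) tvec topology" where
  "tangent_topology M \<C> = topology_generated_by
     {{v \<in> over c (tangent_bundle M \<C>). coords c v \<in> U} | c U. c \<in> \<C> \<and> open U}"

lemma topspace_tangent_topology:
  assumes "smooth_atlas M \<C>"
  shows "topspace (tangent_topology M \<C>) = tangent_bundle M \<C>"
proof -
  have cover: "\<exists>c\<in>\<C>. fst v \<in> fst c" if "v \<in> tangent_bundle M \<C>" for v
  proof -
    have "fst v \<in> topspace M" using that unfolding tangent_bundle_def by force
    moreover have "(\<Union>c\<in>\<C>. fst c) = topspace M" using assms unfolding smooth_atlas_def by (elim conjE)
    ultimately show ?thesis by blast
  qed
  let ?B = "{{v \<in> over c (tangent_bundle M \<C>). coords c v \<in> U} | c U. c \<in> \<C> \<and> open U}"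
  have "\<Union>?B = tangent_bundle M \<C>"
  proof
    show "\<Union>?B \<subseteq> tangent_bundle M \<C>" unfolding over_def by blast
    show "tangent_bundle M \<C> \<subseteq> \<Union>?B"
    proof
      fix v assume v: "v \<in> tangent_bundle M \<C>"
      then obtain c where c: "c \<in> \<C>" "fst v \<in> fst c" using cover by blast
      show "v \<in> \<Union>?B"
      proof (rule UnionI)
        show "{v \<in> over c (tangent_bundle M \<C>). coords c v \<in> UNIV} \<in> ?B" using c(1) open_UNIV by blast
        show "v \<in> {v \<in> over c (tangent_bundle M \<C>). coords c v \<in> UNIV}"
          unfolding over_def using v c(2) by blast
      qed
    qed
  qed
  then show ?thesis unfolding tangent_topology_def topology_generated_by_topspace .
qed

lemma chart_inj: "is_chart M c \<Longrightarrow> inj_on (snd c) (fst c)"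
  unfolding is_chart_def
  by (metis homeomorphic_imp_injective_map openin_subset topspace_subtopology_subset)

lemma transition_at:
  assumes c: "is_chart M c" and p: "p \<in> fst c"
  shows "transition c d (snd c p) = snd d p"
proof -
  show ?thesis using chart_inj[OF c] p by (simp add: transition_def)
qed

lemma chart_open_image:
  assumes c: "is_chart M c" and U: "openin M U"
  shows "open (snd c ` (fst c \<inter> U))"
proof -
  have "openin (subtopology M (fst c)) (fst c \<inter> U)"
    by (metis U inf_commute openin_subtopology_Int)
  moreover have "open_map (subtopology M (fst c)) (top_of_set (snd c ` fst c)) (snd c)"
    using c unfolding is_chart_def by (meson homeomorphic_imp_open_map)
  ultimately have "openin (top_of_set (snd c ` fst c)) (snd c ` (fst c \<inter> U))"
    unfolding open_map_def by blast
  then show ?thesis using c unfolding is_chart_def by (meson openin_open_trans)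
qed

lemma transition_differentiable:
  assumes at: "smooth_atlas M \<C>" and "c \<in> charts_at \<C> p" "d \<in> charts_at \<C> p"
  shows "transition c d differentiable (at (snd c p))"
proof -
  have "compatible c d" using assms unfolding smooth_atlas_def charts_at_def by blast
  then have "Ck_on (Suc 0) (snd c ` (fst c \<inter> fst d)) (transition c d)"
    unfolding compatible_def smooth_on_def by blast
  then show ?thesis using assms by (auto simp: charts_at_def)
qed

lemma transition_cocycle:
  assumes at: "smooth_atlas M \<C>" and c: "c \<in> charts_at \<C> p" and d: "d \<in> charts_at \<C> p"
    and e: "e \<in> charts_at \<C> p"
  shows "frechet_derivative (transition c e) (at (snd c p)) y =
    frechet_derivative (transition d e) (at (snd d p)) (frechet_derivative (transition c d) (at (snd c p)) y)"
proof -
  have ch: "is_chart M c" "is_chart M d" "is_chart M e" "p \<in> fst c" "p \<in> fst d" "p \<in> fst e"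
    using assms unfolding smooth_atlas_def charts_at_def by blast+
  note dc = transition_differentiable[OF at c d] and de = transition_differentiable[OF at d e]
  have "(transition c d has_derivative frechet_derivative (transition c d) (at (snd c p))) (at (snd c p))"
    using dc by (simp add: frechet_derivative_works)
  moreover have "(transition d e has_derivative frechet_derivative (transition d e) (at (snd d p)))
      (at (transition c d (snd c p)))"
    using de transition_at[OF ch(1,4)] by (simp add: frechet_derivative_works)
  ultimately have "(transition d e \<circ> transition c d has_derivative
     frechet_derivative (transition d e) (at (snd d p)) \<circ> frechet_derivative (transition c d) (at (snd c p)))
     (at (snd c p))" by (rule diff_chain_at)
  moreover have "open (snd c ` (fst c \<inter> fst d))"
    using ch chart_open_image unfolding is_chart_def[of M d] by blast
  moreover have "snd c p \<in> snd c ` (fst c \<inter> fst d)" using ch by blast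
  moreover have "(transition d e \<circ> transition c d) x = transition c e x" if x: "x \<in> snd c ` (fst c \<inter> fst d)" for x
  proof -
    obtain q where q: "q \<in> fst c" "q \<in> fst d" "x = snd c q" using x by blast
    show ?thesis using transition_at[OF ch(1) q(1)] transition_at[OF ch(2) q(2)] q(3) by simp
  qed
  ultimately have "(transition c e has_derivative
     frechet_derivative (transition d e) (at (snd d p)) \<circ> frechet_derivative (transition c d) (at (snd c p)))
     (at (snd c p))" using has_derivative_transform_within_open by blast
  then show ?thesis by (metis comp_apply frechet_derivative_at)
qed

lemma transition_self:
  assumes at: "smooth_atlas M \<C>" and c: "c \<in> charts_at \<C> p"
  shows "frechet_derivative (transition c c) (at (snd c p)) y = y"
proof -
  have ch: "is_chart M c" "p \<in> fst c"
    using assms unfolding smooth_atlas_def charts_at_def by blast+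
  have "((\<lambda>x. x) has_derivative (\<lambda>x. x)) (at (snd c p))" by (rule has_derivative_ident)
  moreover have "open (snd c ` fst c)" using ch unfolding is_chart_def by blast
  moreover have "snd c p \<in> snd c ` fst c" using ch by blast
  moreover have "x = transition c c x" if x: "x \<in> snd c ` fst c" for x
  proof -
    obtain q where "q \<in> fst c" "x = snd c q" using x by blast
    then show ?thesis using transition_at[OF ch(1), of q c] by simp
  qed
  ultimately have "(transition c c has_derivative (\<lambda>x. x)) (at (snd c p))"
    using has_derivative_transform_within_open[of "\<lambda>x. x" "\<lambda>x. x" "snd c p" UNIV "snd c ` fst c" "transition c c"] by simp
  then show ?thesis by (metis frechet_derivative_at)
qed

lemma tangent_bundle_iff:
  "v \<in> tangent_bundle M \<C> \<longleftrightarrow> fst v \<in> topspace M \<and>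
     (\<forall>c. c \<notin> charts_at \<C> (fst v) \<longrightarrow> snd v c = 0) \<and>
     (\<forall>c\<in>charts_at \<C> (fst v). \<forall>d\<in>charts_at \<C> (fst v).
        snd v d = frechet_derivative (transition c d) (at (snd c (fst v))) (snd v c))"
  unfolding tangent_bundle_def by (cases v) (simp only: mem_Collect_eq case_prod_conv fst_conv snd_conv)

text \<open>The induced coordinates identify \<open>TU\<close> with \<open>\<phi>(U) \<times> \<real>\<^sup>n\<close>; in particular the inverse used in
  \<^const>\<open>coord_rep\<close> is a genuine one.\<close>

lemma bij_betw_coords:
  assumes at: "smooth_atlas M \<C>" and c: "c \<in> \<C>"
  shows "bij_betw (coords c) (over c (tangent_bundle M \<C>)) ((snd c ` fst c) \<times> UNIV)"
proof (rule bij_betw_imageI)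
  have ch: "is_chart M c" using assms unfolding smooth_atlas_def by blast
  show "inj_on (coords c) (over c (tangent_bundle M \<C>))"
  proof (rule inj_onI)
    fix u v assume u: "u \<in> over c (tangent_bundle M \<C>)" and v: "v \<in> over c (tangent_bundle M \<C>)"
      and eq: "coords c u = coords c v"
    have p: "fst u \<in> fst c" "fst v \<in> fst c" using u v unfolding over_def by blast+
    have e: "snd c (fst u) = snd c (fst v)" "snd u c = snd v c" using eq unfolding coords_def by blast+
    have f: "fst u = fst v" using chart_inj[OF ch] p e(1) by (meson inj_onD)
    have cc: "c \<in> charts_at \<C> (fst u)" using p c unfolding charts_at_def by blast
    have "snd u d = snd v d" for d
    proof (cases "d \<in> charts_at \<C> (fst u)")
      case True
      then have "snd u d = frechet_derivative (transition c d) (at (snd c (fst u))) (snd u c)"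
        "snd v d = frechet_derivative (transition c d) (at (snd c (fst v))) (snd v c)"
        using u v cc f True unfolding over_def tangent_bundle_iff mem_Collect_eq by metis+
      then show ?thesis using e by metis
    next
      case False
      then show ?thesis using u v f unfolding over_def tangent_bundle_iff mem_Collect_eq by metis
    qed
    then show "u = v" using f by (simp add: prod_eq_iff fun_eq_iff)
  qed
  show "coords c ` over c (tangent_bundle M \<C>) = (snd c ` fst c) \<times> UNIV"
  proof
    show "coords c ` over c (tangent_bundle M \<C>) \<subseteq> (snd c ` fst c) \<times> UNIV"
      unfolding coords_def over_def by blast
    show "(snd c ` fst c) \<times> UNIV \<subseteq> coords c ` over c (tangent_bundle M \<C>)"
    proof
      fix z :: "(real^'b) \<times> (real^'b)" assume "z \<in> (snd c ` fst c) \<times> UNIV"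
      then obtain p y where z: "z = (snd c p, y)" and p: "p \<in> fst c" by blast
      define w where "w d = (if d \<in> charts_at \<C> p
        then frechet_derivative (transition c d) (at (snd c p)) y else 0)" for d
      have cc: "c \<in> charts_at \<C> p" using p c unfolding charts_at_def by blast
      have "p \<in> topspace M" using ch p unfolding is_chart_def by (meson openin_subset subsetD)
      moreover have "w e = frechet_derivative (transition d e) (at (snd d p)) (w d)"
        if "d \<in> charts_at \<C> p" "e \<in> charts_at \<C> p" for d e
        using that transition_cocycle[OF at cc that] by (simp add: w_def)
      moreover have w0: "w d = 0" if "d \<notin> charts_at \<C> p" for d using that by (simp add: w_def)
      ultimately have "(p, w) \<in> over c (tangent_bundle M \<C>)"
        using p w0 unfolding over_def tangent_bundle_iff mem_Collect_eq fst_conv snd_conv by blast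
      moreover have "coords c (p, w) = z"
        using transition_self[OF at cc] cc by (simp add: coords_def w_def z)
      ultimately show "z \<in> coords c ` over c (tangent_bundle M \<C>)" by force
    qed
  qed
qed


section \<open>Conic domains\<close>

definition conic_domain :: "'m topology \<Rightarrow> ('m, 'n::finite) chart set \<Rightarrow> ('m, 'n) tvec set \<Rightarrow> bool" where
  "conic_domain M \<C> A \<longleftrightarrow>
     A \<subseteq> slit_bundle M \<C> \<and> openin (tangent_topology M \<C>) A \<and>
     (\<forall>v\<in>A. \<forall>t>0. tscale t v \<in> A) \<and> fst ` A = topspace M"

definition slit_closure :: "'m topology \<Rightarrow> ('m, 'n::finite) chart set
    \<Rightarrow> ('m, 'n) tvec set \<Rightarrow> ('m, 'n) tvec set" where
  "slit_closure M \<C> A =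
     (subtopology (tangent_topology M \<C>) (slit_bundle M \<C>)) closure_of A"

definition slit_boundary :: "'m topology \<Rightarrow> ('m, 'n::finite) chart set
    \<Rightarrow> ('m, 'n) tvec set \<Rightarrow> ('m, 'n) tvec set" where
  "slit_boundary M \<C> A = slit_closure M \<C> A - A"

text \<open>In the chart \<open>c\<close>, the function \<open>h\<close> is a smooth extension of \<open>f\<close> (given on \<open>A\<close>) to the closure
  of \<open>A\<close>: as usual for sets that are not open, \<open>h\<close> is required to be smooth on an open
  neighbourhood of the closure. The values and all derivatives of \<open>h\<close> on the closure are determined
  by \<open>f\<close>, since \<open>A\<close> is open.\<close>

definition smooth_extension :: "'m topology \<Rightarrow> ('m, 'n::finite) chart set \<Rightarrow> ('m, 'n) tvec set
    \<Rightarrow> ('m, 'n) chart \<Rightarrow> ((real^'n) \<times> (real^'n) \<Rightarrow> real) \<Rightarrow> ((real^'n) \<times> (real^'n) \<Rightarrow> real) \<Rightarrow> bool" where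
  "smooth_extension M \<C> A c f h \<longleftrightarrow>
     (\<exists>W. open W \<and> coord_set c (slit_closure M \<C> A) \<subseteq> W \<and> smooth_on W h) \<and>
     (\<forall>z\<in>coord_set c A. h z = f z)"


section \<open>Nonlinear connections\<close>

text \<open>\<open>N c k i\<close> is the component \<open>N\<^sub>i\<^sup>k\<close> in the chart \<open>c\<close>, as a function of \<open>(x, y)\<close>. In the
  transformation law, \<open>c\<close> carries the coordinates \<open>x\<close> and \<open>d\<close> the barred coordinates.\<close>

type_synonym ('m, 'n) connection =
  "('m, 'n) chart \<Rightarrow> 'n \<Rightarrow> 'n \<Rightarrow> (real^'n) \<times> (real^'n) \<Rightarrow> real"

definition nonlinear_connection :: "'m topology \<Rightarrow> ('m, 'n::finite) chart set \<Rightarrow> ('m, 'n) tvec set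
    \<Rightarrow> ('m, 'n) connection \<Rightarrow> bool" where
  "nonlinear_connection M \<C> A N \<longleftrightarrow>
     (\<forall>c\<in>\<C>. \<forall>k i. smooth_on (coord_set c A) (N c k i)) \<and>
     (\<forall>c\<in>\<C>. \<forall>k i. \<forall>(x, y)\<in>coord_set c A. \<forall>t>0. N c k i (x, t *\<^sub>R y) = t * N c k i (x, y)) \<and>
     (\<forall>c\<in>\<C>. \<forall>d\<in>\<C>. \<forall>v\<in>over c (over d A). \<forall>k i.
        let x = fst (coords c v); x' = fst (coords d v); y' = snd (coords d v) in
        N d k i (coords d v) =
          (\<Sum>l\<in>UNIV. \<Sum>b\<in>UNIV.
             pderiv_at l (\<lambda>u. transition c d u $ k) x *
             pderiv_at i (pderiv_at b (\<lambda>u. transition d c u $ l)) x' * y' $ b) +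
          (\<Sum>l\<in>UNIV. \<Sum>a\<in>UNIV.
             pderiv_at l (\<lambda>u. transition c d u $ k) x *
             pderiv_at i (\<lambda>u. transition d c u $ a) x' * N c l a (coords c v)))"

definition connection_extends_smoothly :: "'m topology \<Rightarrow> ('m, 'n::finite) chart set
    \<Rightarrow> ('m, 'n) tvec set \<Rightarrow> ('m, 'n) connection \<Rightarrow> bool" where
  "connection_extends_smoothly M \<C> A N \<longleftrightarrow>
     (\<forall>c\<in>\<C>. \<forall>k i. \<exists>h. smooth_extension M \<C> A c (N c k i) h)"

definition delta :: "('m, 'n::finite) connection \<Rightarrow> ('m, 'n) chart \<Rightarrow> 'n
    \<Rightarrow> ((real^'n) \<times> (real^'n) \<Rightarrow> real) \<Rightarrow> (real^'n) \<times> (real^'n) \<Rightarrow> real" where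
  "delta N c i f z = dx i f z - (\<Sum>a\<in>UNIV. N c a i z * dy a f z)"

text \<open>\<open>curvature N c k i j\<close> is the component with upper index \<open>k\<close> and lower indices \<open>i j\<close>.\<close>

definition curvature :: "('m, 'n::finite) connection \<Rightarrow> ('m, 'n) chart \<Rightarrow> 'n \<Rightarrow> 'n \<Rightarrow> 'n
    \<Rightarrow> (real^'n) \<times> (real^'n) \<Rightarrow> real" where
  "curvature N c k i j z = delta N c j (N c k i) z - delta N c i (N c k j) z"

text \<open>The Ricci scalar, expressed in the chart \<open>c\<close>; it is invariant under change of chart.\<close>

definition ricci :: "('m, 'n::finite) connection \<Rightarrow> ('m, 'n) chart \<Rightarrow> (real^'n) \<times> (real^'n) \<Rightarrow> real" where
  "ricci N c z = (\<Sum>b\<in>UNIV. \<Sum>a\<in>UNIV. snd z $ b * curvature N c a b a z)"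


section \<open>Pseudo-Finsler and Lorentz-Finsler metrics\<close>

text \<open>The matrix \<open>g\<^sub>i\<^sub>j\<close> at \<open>z\<close> of the coordinate expression \<open>f\<close> of a metric.\<close>

definition fundamental_tensor :: "((real^'n) \<times> (real^'n) \<Rightarrow> real) \<Rightarrow> (real^'n::finite) \<times> (real^'n) \<Rightarrow> real^'n^'n" where
  "fundamental_tensor f z = (\<chi> i j. dy j (dy i f) z / 2)"

definition pseudo_finsler :: "'m topology \<Rightarrow> ('m, 'n::finite) chart set \<Rightarrow> ('m, 'n) tvec set
    \<Rightarrow> (('m, 'n) tvec \<Rightarrow> real) \<Rightarrow> bool" where
  "pseudo_finsler M \<C> A L \<longleftrightarrow>
     (\<forall>c\<in>\<C>. smooth_on (coord_set c A) (coord_rep M \<C> c L)) \<and>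
     (\<forall>v\<in>A. \<forall>t>0. L (tscale t v) = t\<^sup>2 * L v) \<and>
     (\<forall>c\<in>\<C>. \<forall>z\<in>coord_set c A. invertible (fundamental_tensor (coord_rep M \<C> c L) z))"

definition proper_metric :: "'m topology \<Rightarrow> ('m, 'n::finite) chart set \<Rightarrow> ('m, 'n) tvec set
    \<Rightarrow> (('m, 'n) tvec \<Rightarrow> real) \<Rightarrow> bool" where
  "proper_metric M \<C> A L \<longleftrightarrow>
     (\<forall>p\<in>topspace M. connectedin (tangent_topology M \<C>) {v \<in> A. fst v = p}) \<and>
     (\<forall>v\<in>A. L v > 0) \<and>
     (\<forall>c\<in>\<C>. \<exists>h. smooth_extension M \<C> A c (coord_rep M \<C> c L) h \<and>
        (\<forall>z\<in>coord_set c (slit_boundary M \<C> A).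
           h z = 0 \<and> invertible (fundamental_tensor h z)))"

text \<open>Signature \<open>(+,-,\<dots>,-)\<close>, in the sense of Sylvester's law of inertia.\<close>

definition lorentzian_matrix :: "real^'n^'n \<Rightarrow> bool" where
  "lorentzian_matrix G \<longleftrightarrow> (\<exists>(P::real^'n^'n) k. invertible P \<and>
     transpose P ** G ** P = (\<chi> i j. if i \<noteq> j then 0 else if i = k then 1 else - 1))"

definition lorentz_finsler :: "'m topology \<Rightarrow> ('m, 'n::finite) chart set \<Rightarrow> ('m, 'n) tvec set
    \<Rightarrow> (('m, 'n) tvec \<Rightarrow> real) \<Rightarrow> bool" where
  "lorentz_finsler M \<C> A L \<longleftrightarrow>
     pseudo_finsler M \<C> A L \<and> proper_metric M \<C> A L \<and>
     (\<forall>c\<in>\<C>. \<forall>z\<in>coord_set c A. lorentzian_matrix (fundamental_tensor (coord_rep M \<C> c L) z))"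

end

theory Submission
  imports Defs
begin

text \<open>The equation forces \<open>Ric = 0\<close> on each tangent space separately. Fix a chart and a base point, let
  \<open>B \<subseteq> \<real>\<^sup>n\<close> be the corresponding open cone of directions, and write \<open>L\<close> and \<open>f\<close> for the restrictions to the
  fibre of the metric and of the Ricci scalar. Both are positively \<open>2\<close>-homogeneous, and both extend
  smoothly to a neighbourhood of the closure of \<open>B\<close> without the origin.

  Put \<open>S = g\<^sup>a\<^sup>b f\<^sub>\<cdot>\<^sub>a\<^sub>\<cdot>\<^sub>b / (n + 2)\<close>. The hypothesis says that \<open>f = L S\<close> on \<open>B\<close>, so \<open>S\<close> is the
  \<open>0\<close>-homogeneous quotient \<open>f / L\<close>; but its formula is smooth up to the boundary, where \<open>L\<close> vanishes and
  \<open>g\<close> is still invertible. Taking the trace of the Hessian of \<open>L S\<close> and using Euler's relations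
  (\<open>metric_trace_mult\<close>) turns the hypothesis into
  \<open>(2 - n) S = L g\<^sup>a\<^sup>b S\<^sub>\<cdot>\<^sub>a\<^sub>\<cdot>\<^sub>b\<close>
  on \<open>B\<close>, and by continuity also on its boundary. As \<open>L = 0\<close> there and \<open>n \<noteq> 2\<close>, the function \<open>S\<close> vanishes on
  the boundary.

  The rest is a maximum principle. The unit vectors of the closure of \<open>B\<close> form a compact set, on
  which \<open>S\<close> attains a maximum; by homogeneity it is a maximum over all of \<open>B\<close>. If it were positive, it would be
  attained at some \<open>y\<close> in \<open>B\<close> itself. There the Hessian of \<open>S\<close> is negative semidefinite and, \<open>S\<close> being
  constant along rays, null in the direction of \<open>y\<close>, which is timelike since \<open>g(y, y) = L > 0\<close>. On the orthogonal complement
  of a timelike direction \<open>g\<close> is negative definite, so \<open>g\<^sup>a\<^sup>b S\<^sub>\<cdot>\<^sub>a\<^sub>\<cdot>\<^sub>b \<ge> 0\<close> (\<open>lorentzian_trace_nonneg\<close>),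
  whereas the equation with \<open>n \<ge> 3\<close> makes it negative. Hence \<open>S \<le> 0\<close>
  (\<open>lorentzian_cone_nonpos\<close>), and the same argument for \<open>- f\<close> gives \<open>f = 0\<close> (\<open>lorentzian_cone_vanish\<close>).

  To reach this situation on a manifold one needs that induced coordinates carry the topology of the tangent
  bundle to that of \<open>\<real>\<^sup>n \<times> \<real>\<^sup>n\<close> (\<open>open_coord_set\<close>, \<open>closure_coord_set_in_slit_closure\<close>), and that the Ricci
  scalar is a smooth differential expression in the connection, of degree \<open>2\<close> in \<open>y\<close>
  (\<open>smooth_on_ricci\<close>, \<open>ricci_homogeneous\<close>).\<close>

section \<open>Calculus of smooth functions\<close>

text \<open>Functions that agree near a point have the same, possibly empty, set of derivatives there,
  hence the same value of the choice operator behind \<^const>\<open>frechet_derivative\<close>.\<close>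

lemma frechet_derivative_cong_open:
  assumes "open S" "x \<in> S" "\<And>y. y \<in> S \<Longrightarrow> f y = g y"
  shows "frechet_derivative f (at x) = frechet_derivative g (at x)"
proof -
  have "(f has_derivative D) (at x) \<longleftrightarrow> (g has_derivative D) (at x)" for D
    using assms has_derivative_transform_within_open[of f D x UNIV S g]
      has_derivative_transform_within_open[of g D x UNIV S f] by auto
  then show ?thesis by (simp add: frechet_derivative_def)
qed

lemma differentiable_cong_open:
  assumes "open S" "x \<in> S" "\<And>y. y \<in> S \<Longrightarrow> f y = g y" "f differentiable (at x)"
  shows "g differentiable (at x)"
  using assms has_derivative_transform_within_open[of f _ x UNIV S g]
  unfolding differentiable_def by fastforce

lemma Ck_on_cong:
  assumes "open S" "\<And>y. y \<in> S \<Longrightarrow> f y = g y" "Ck_on k S f"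
  shows "Ck_on k S g"
  using assms(2,3)
proof (induction k arbitrary: f g)
  case 0
  then show ?case using continuous_on_cong[of S S f g] by simp
next
  case (Suc k)
  have "Ck_on k S (\<lambda>x. frechet_derivative g (at x) v)" for v
  proof (rule Suc.IH)
    show "frechet_derivative f (at y) v = frechet_derivative g (at y) v" if "y \<in> S" for y
      using frechet_derivative_cong_open[OF assms(1) that, of f g] Suc.prems(1) by simp
    show "Ck_on k S (\<lambda>x. frechet_derivative f (at x) v)" using Suc.prems(2) by simp
  qed
  moreover have "g differentiable (at x)" if "x \<in> S" for x
    using differentiable_cong_open[OF assms(1) that, of f g] Suc.prems that by simp
  ultimately show ?case by simp
qed

lemma Ck_on_subset: "Ck_on k S f \<Longrightarrow> T \<subseteq> S \<Longrightarrow> Ck_on k T f"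
  by (induction k arbitrary: f) (auto intro: continuous_on_subset)

lemma Ck_on_Suc_D: "Ck_on (Suc k) S f \<Longrightarrow> Ck_on k S f"
proof (induction k arbitrary: f)
  case 0
  then show ?case
    by (auto intro!: continuous_at_imp_continuous_on differentiable_imp_continuous_within)
next
  case (Suc k)
  then show ?case by simp
qed

text \<open>The derivative in \<^const>\<open>Ck_on\<close> is a choice; this rule allows working with any explicit formula for it.\<close>

lemma Ck_on_SucI:
  assumes "open S" "\<And>x. x \<in> S \<Longrightarrow> (f has_derivative D x) (at x)" "\<And>v. Ck_on k S (\<lambda>x. D x v)"
  shows "Ck_on (Suc k) S f"
proof -
  have "Ck_on k S (\<lambda>x. frechet_derivative f (at x) v)" for v
  proof (rule Ck_on_cong[OF assms(1)])
    show "D y v = frechet_derivative f (at y) v" if "y \<in> S" for y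
      using frechet_derivative_at[OF assms(2)[OF that]] by simp
  qed (rule assms(3))
  then show ?thesis using assms(2) by (auto simp: differentiable_def)
qed

lemma Ck_on_Suc_has_derivative:
  "Ck_on (Suc k) S f \<Longrightarrow> x \<in> S \<Longrightarrow> (f has_derivative frechet_derivative f (at x)) (at x)"
  by (simp add: frechet_derivative_works)

lemma Ck_on_const: "open S \<Longrightarrow> Ck_on k S (\<lambda>_. c)"
proof (induction k arbitrary: c)
  case (Suc k)
  show ?case by (rule Ck_on_SucI[OF Suc.prems, where D = "\<lambda>_ _. 0"]) (auto intro: Suc)
qed simp

lemma Ck_on_bounded_linear: "open S \<Longrightarrow> bounded_linear f \<Longrightarrow> Ck_on k S f"
proof (cases k)
  case (Suc k)
  assume "open S" "bounded_linear f"
  then show ?thesis unfolding Suc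
    by (intro Ck_on_SucI[where D = "\<lambda>_. f"]) (auto intro: Ck_on_const bounded_linear_imp_has_derivative)
qed (auto simp: linear_continuous_on)

lemma Ck_on_Suc_frechet: "Ck_on (Suc k) S f \<Longrightarrow> Ck_on k S (\<lambda>x. frechet_derivative f (at x) v)"
  by simp

lemma Ck_on_add:
  assumes S: "open S"
  shows "Ck_on k S f \<Longrightarrow> Ck_on k S g \<Longrightarrow> Ck_on k S (\<lambda>x. f x + g x)"
proof (induction k arbitrary: f g)
  case (Suc k)
  show ?case
  proof (rule Ck_on_SucI[OF S])
    show "((\<lambda>x. f x + g x) has_derivative
        (\<lambda>v. frechet_derivative f (at x) v + frechet_derivative g (at x) v)) (at x)" if "x \<in> S" for x
      by (intro has_derivative_add Ck_on_Suc_has_derivative[OF Suc.prems(1) that]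
          Ck_on_Suc_has_derivative[OF Suc.prems(2) that])
    show "Ck_on k S (\<lambda>x. frechet_derivative f (at x) v + frechet_derivative g (at x) v)" for v
      by (intro Suc.IH Ck_on_Suc_frechet Suc.prems)
  qed
qed (auto intro: continuous_intros)

lemma Ck_on_mult:
  fixes f g :: "'a::real_normed_vector \<Rightarrow> real"
  assumes S: "open S"
  shows "Ck_on k S f \<Longrightarrow> Ck_on k S g \<Longrightarrow> Ck_on k S (\<lambda>x. f x * g x)"
proof (induction k arbitrary: f g)
  case (Suc k)
  show ?case
  proof (rule Ck_on_SucI[OF S])
    show "((\<lambda>x. f x * g x) has_derivative
        (\<lambda>v. f x * frechet_derivative g (at x) v + frechet_derivative f (at x) v * g x)) (at x)"
      if "x \<in> S" for x
      by (intro has_derivative_mult Ck_on_Suc_has_derivative[OF Suc.prems(1) that]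
          Ck_on_Suc_has_derivative[OF Suc.prems(2) that])
    show "Ck_on k S (\<lambda>x. f x * frechet_derivative g (at x) v + frechet_derivative f (at x) v * g x)" for v
      by (intro Ck_on_add S Suc.IH Ck_on_Suc_frechet Suc.prems Ck_on_Suc_D)
  qed
qed (auto intro: continuous_intros)

lemma Ck_on_inverse:
  fixes f :: "'a::real_normed_vector \<Rightarrow> real"
  assumes S: "open S" and nz: "\<And>x. x \<in> S \<Longrightarrow> f x \<noteq> 0"
  shows "Ck_on k S f \<Longrightarrow> Ck_on k S (\<lambda>x. inverse (f x))"
proof (induction k)
  case (Suc k)
  show ?case
  proof (rule Ck_on_SucI[OF S])
    show "((\<lambda>x. inverse (f x)) has_derivative
        (\<lambda>v. - 1 * (inverse (f x) * frechet_derivative f (at x) v * inverse (f x)))) (at x)"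
      if "x \<in> S" for x
      using Deriv.has_derivative_inverse[OF nz[OF that] Ck_on_Suc_has_derivative[OF Suc.prems that]] by simp
    show "Ck_on k S (\<lambda>x. - 1 * (inverse (f x) * frechet_derivative f (at x) v * inverse (f x)))" for v
      by (intro Ck_on_mult Ck_on_const S Suc.IH Ck_on_Suc_frechet Suc.prems Ck_on_Suc_D[OF Suc.prems])
  qed
qed (use assms in \<open>auto intro: continuous_intros\<close>)

lemma Ck_on_sum:
  assumes "open S"
  shows "finite I \<Longrightarrow> (\<And>i. i \<in> I \<Longrightarrow> Ck_on k S (f i)) \<Longrightarrow> Ck_on k S (\<lambda>x. \<Sum>i\<in>I. f i x)"
  by (induction I rule: finite_induct) (auto intro!: Ck_on_const Ck_on_add assms)

lemma Ck_on_prod: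
  fixes f :: "'i \<Rightarrow> 'a::real_normed_vector \<Rightarrow> real"
  assumes "open S"
  shows "finite I \<Longrightarrow> (\<And>i. i \<in> I \<Longrightarrow> Ck_on k S (f i)) \<Longrightarrow> Ck_on k S (\<lambda>x. \<Prod>i\<in>I. f i x)"
  by (induction I rule: finite_induct) (auto intro!: Ck_on_const Ck_on_mult assms)

lemma Ck_on_det:
  fixes G :: "'a::real_normed_vector \<Rightarrow> real^'n^'n"
  assumes "open S" "\<And>i j. Ck_on k S (\<lambda>x. G x $ i $ j)"
  shows "Ck_on k S (\<lambda>x. det (G x))"
  unfolding det_def
  by (intro Ck_on_sum Ck_on_mult Ck_on_prod Ck_on_const assms) (auto simp: finite_permutations)

text \<open>Cramer's rule writes the entries of the inverse as quotients of polynomials in the entries, which is why they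
  are as smooth as the matrix.\<close>

lemma matrix_inv_entry:
  fixes G :: "real^'n^'n"
  assumes "det G \<noteq> 0"
  shows "matrix_inv G $ a $ b = det (\<chi> i j. if j = a then axis b 1 $ i else G $ i $ j) * inverse (det G)"
proof -
  have "G ** matrix_inv G = mat 1"
    using assms unfolding matrix_inv_def invertible_det_nz[symmetric] invertible_def by (rule someI2_ex) simp
  then have "G *v (matrix_inv G *v axis b 1) = axis b 1" by (simp add: matrix_vector_mul_assoc)
  then have "matrix_inv G *v axis b 1 = (\<chi> k. det (\<chi> i j. if j = k then axis b 1 $ i else G $ i $ j) / det G)"
    using cramer[OF assms] by blast
  moreover have "(matrix_inv G *v axis b 1) $ a = matrix_inv G $ a $ b"
    by (simp add: matrix_vector_mult_basis column_def)
  ultimately show ?thesis by (simp add: divide_inverse)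
qed

lemma Ck_on_matrix_inv:
  fixes G :: "'a::real_normed_vector \<Rightarrow> real^'n^'n"
  assumes S: "open S" and G: "\<And>i j. Ck_on k S (\<lambda>x. G x $ i $ j)"
    and nz: "\<And>x. x \<in> S \<Longrightarrow> det (G x) \<noteq> 0"
  shows "Ck_on k S (\<lambda>x. matrix_inv (G x) $ a $ b)"
proof (rule Ck_on_cong[OF S])
  show "det (\<chi> i j. if j = a then axis b 1 $ i else G x $ i $ j) * inverse (det (G x))
      = matrix_inv (G x) $ a $ b" if "x \<in> S" for x
    using matrix_inv_entry[OF nz[OF that]] by simp
  have "Ck_on k S (\<lambda>x. if j = a then axis b 1 $ i else G x $ i $ j)" for i j
    using G S by (cases "j = a") (auto intro: Ck_on_const)
  then show "Ck_on k S (\<lambda>x. det (\<chi> i j. if j = a then axis b 1 $ i else G x $ i $ j) * inverse (det (G x)))"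
    by (intro Ck_on_mult Ck_on_inverse Ck_on_det S nz G) simp_all
qed

lemma open_Collect_Pair: "open W \<Longrightarrow> open {y. (x, y) \<in> W}"
  using open_vimage[of W "\<lambda>y. (x, y)"] continuous_on_Pair[OF continuous_on_const continuous_on_id, of UNIV x]
  by (simp add: vimage_def id_def)

text \<open>Differentiating along the fibre over \<open>x\<close> is differentiating in the directions \<open>(0, v)\<close>, so no derivative is lost
  when the base point is frozen.\<close>

lemma Ck_on_fibre:
  assumes W: "open W"
  shows "Ck_on k W h \<Longrightarrow> Ck_on k {y. (x, y) \<in> W} (\<lambda>y. h (x, y))"
proof (induction k arbitrary: h)
  case 0
  then show ?case by (auto intro!: continuous_on_compose2[of W h] continuous_intros)
next
  case (Suc k)
  have "open {y. (x, y) \<in> W}"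
    by (rule open_Collect_Pair[OF W])
  moreover have "((\<lambda>y. h (x, y)) has_derivative (\<lambda>v. frechet_derivative h (at (x, y)) (0, v))) (at y)"
    if "y \<in> {y. (x, y) \<in> W}" for y
  proof -
    have "((\<lambda>y. (x, y)) has_derivative (\<lambda>v. (0, v))) (at y)" by (auto intro!: derivative_eq_intros)
    then show ?thesis using has_derivative_compose[of "\<lambda>y. (x, y)" _ y UNIV h "frechet_derivative h (at (x, y))"]
      Ck_on_Suc_has_derivative[OF Suc.prems] that by simp
  qed
  moreover have "Ck_on k {y. (x, y) \<in> W} (\<lambda>y. frechet_derivative h (at (x, y)) (0, v))" for v
    using Suc.IH[of "\<lambda>z. frechet_derivative h (at z) (0, v)"] Suc.prems by simp
  ultimately show ?case by (rule Ck_on_SucI)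
qed

lemma smooth_on_open_continuous: "smooth_on S f \<Longrightarrow> continuous_on S f"
  unfolding smooth_on_def by (metis Ck_on.simps(1))

lemma smooth_on_has_derivative:
  "smooth_on S f \<Longrightarrow> x \<in> S \<Longrightarrow> (f has_derivative frechet_derivative f (at x)) (at x)"
  unfolding smooth_on_def by (metis Ck_on_Suc_has_derivative)

lemma smooth_on_frechet_derivative: "smooth_on S f \<Longrightarrow> smooth_on S (\<lambda>x. frechet_derivative f (at x) v)"
  unfolding smooth_on_def by (metis Ck_on.simps(2))

lemma smooth_on_pderiv_at: "smooth_on S f \<Longrightarrow> smooth_on S (pderiv_at i f)"
  using smooth_on_frechet_derivative[of S f "axis i 1"] by (simp add: pderiv_at_def[abs_def])

lemma smooth_on_dx: "smooth_on S f \<Longrightarrow> smooth_on S (dx i f)"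
  using smooth_on_frechet_derivative[of S f "(axis i 1, 0)"] by (simp add: dx_def[abs_def])

lemma smooth_on_dy: "smooth_on S f \<Longrightarrow> smooth_on S (dy i f)"
  using smooth_on_frechet_derivative[of S f "(0, axis i 1)"] by (simp add: dy_def[abs_def])

lemma smooth_on_subset: "smooth_on S f \<Longrightarrow> T \<subseteq> S \<Longrightarrow> smooth_on T f"
  unfolding smooth_on_def using Ck_on_subset by blast

lemma smooth_on_ring:
  fixes f g :: "'a::real_normed_vector \<Rightarrow> real"
  assumes "open S"
  shows smooth_on_const: "smooth_on S (\<lambda>_. c::real)"
    and smooth_on_mult: "smooth_on S f \<Longrightarrow> smooth_on S g \<Longrightarrow> smooth_on S (\<lambda>x. f x * g x)"
    and smooth_on_diff: "smooth_on S f \<Longrightarrow> smooth_on S g \<Longrightarrow> smooth_on S (\<lambda>x. f x - g x)"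
proof -
  have add: "smooth_on S f \<Longrightarrow> smooth_on S g \<Longrightarrow> smooth_on S (\<lambda>x. f x + g x)" for f g :: "'a \<Rightarrow> real"
    unfolding smooth_on_def using assms Ck_on_add[of S _ f g] by blast
  show const: "smooth_on S (\<lambda>_. c::real)" for c unfolding smooth_on_def using assms Ck_on_const by blast
  show mult: "smooth_on S f \<Longrightarrow> smooth_on S g \<Longrightarrow> smooth_on S (\<lambda>x. f x * g x)" for f g :: "'a \<Rightarrow> real"
    unfolding smooth_on_def using assms Ck_on_mult[of S _ f g] by blast
  show "smooth_on S f \<Longrightarrow> smooth_on S g \<Longrightarrow> smooth_on S (\<lambda>x. f x - g x)"
    using add[OF _ mult[OF const[of "-1"]], of f g] by simp
qed

lemma smooth_on_sum:
  fixes f :: "'i \<Rightarrow> 'a::real_normed_vector \<Rightarrow> real"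
  assumes "open S" "finite I" "\<And>i. i \<in> I \<Longrightarrow> smooth_on S (f i)"
  shows "smooth_on S (\<lambda>x. \<Sum>i\<in>I. f i x)"
  using assms Ck_on_sum[of S I _ f] unfolding smooth_on_def by blast

lemma smooth_on_matrix_inv:
  fixes G :: "'a::real_normed_vector \<Rightarrow> real^'n^'n"
  assumes "open S" "\<And>i j. smooth_on S (\<lambda>x. G x $ i $ j)" "\<And>x. x \<in> S \<Longrightarrow> det (G x) \<noteq> 0"
  shows "smooth_on S (\<lambda>x. matrix_inv (G x) $ a $ b)"
  using assms Ck_on_matrix_inv[of S _ G a b] unfolding smooth_on_def by blast

lemma smooth_on_det:
  fixes G :: "'a::real_normed_vector \<Rightarrow> real^'n^'n"
  assumes "open S" "\<And>i j. smooth_on S (\<lambda>x. G x $ i $ j)"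
  shows "smooth_on S (\<lambda>x. det (G x))"
  using assms Ck_on_det[of S _ G] unfolding smooth_on_def by blast

lemma smooth_on_bounded_linear: "open S \<Longrightarrow> bounded_linear f \<Longrightarrow> smooth_on S f"
  unfolding smooth_on_def using Ck_on_bounded_linear by blast

lemma smooth_on_fibre: "open W \<Longrightarrow> smooth_on W h \<Longrightarrow> smooth_on {y. (x, y) \<in> W} (\<lambda>y. h (x, y))"
  unfolding smooth_on_def using Ck_on_fibre by blast

section \<open>Traces with respect to a Lorentzian matrix\<close>

text \<open>Otherwise \<open>Q\<close> would take negative values near \<open>y\<close>, on the line through \<open>y\<close> in direction \<open>w\<close>. Here
  \<open>Q\<close> stands for a matrix of iterated partial derivatives, whose symmetry is a separate matter; hence the cross
  terms come as a sum.\<close>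

lemma psd_isotropic_cross:
  fixes Q :: "'v::real_vector \<Rightarrow> 'v \<Rightarrow> real"
  assumes Q: "bilinear Q" and psd: "\<And>w. Q w w \<ge> 0" and y: "Q y y = 0"
  shows "Q y w + Q w y = 0"
proof (rule ccontr)
  define c q where "c = Q y w + Q w y" and "q = Q w w"
  assume "Q y w + Q w y \<noteq> 0"
  then have c: "c \<noteq> 0" by (simp add: c_def)
  have q: "q \<ge> 0" using psd by (simp add: q_def)
  \<comment> \<open>With \<open>t = - c / q\<close> the value would only be \<open>0\<close>; the larger denominator makes it \<open>- t\<^sup>2\<close>, also for \<open>q = 0\<close>.\<close>
  define t where "t = - c / (q + 1)"
  have "Q (y + t *\<^sub>R w) (y + t *\<^sub>R w) = t * c + t\<^sup>2 * q"
    using y by (simp add: c_def q_def bilinear_ladd[OF Q] bilinear_radd[OF Q] bilinear_lmul[OF Q]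
        bilinear_rmul[OF Q] power2_eq_square algebra_simps)
  also have "\<dots> = - t\<^sup>2"
  proof -
    have c: "c = - t * (q + 1)" using q by (simp add: t_def)
    show ?thesis by (subst c) (simp add: power2_eq_square algebra_simps)
  qed
  finally show False using psd[of "y + t *\<^sub>R w"] c q by (simp add: t_def)
qed

text \<open>This is Cauchy--Schwarz, obtained from the Lagrange identity: the vectors \<open>z\<^sub>i e\<^sub>j - z\<^sub>j e\<^sub>i\<close> have
  nonnegative \<open>Q\<close>, and summing over \<open>i\<close> and \<open>j\<close> gives twice the difference of the two sides.\<close>

lemma psd_sum_le:
  fixes Q :: "'v::real_vector \<Rightarrow> 'v \<Rightarrow> real"
  assumes Q: "bilinear Q" and psd: "\<And>w. Q w w \<ge> 0" and I: "finite I"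
  shows "Q (\<Sum>i\<in>I. z i *\<^sub>R e i) (\<Sum>i\<in>I. z i *\<^sub>R e i) \<le> (\<Sum>i\<in>I. (z i)\<^sup>2) * (\<Sum>i\<in>I. Q (e i) (e i))"
proof -
  define u where "u = (\<Sum>i\<in>I. z i *\<^sub>R e i)"
  have u: "Q u u = (\<Sum>i\<in>I. \<Sum>j\<in>I. z i * z j * Q (e i) (e j))"
    unfolding u_def bilinear_sum[OF Q] sum.cartesian_product[symmetric]
    by (simp add: bilinear_lmul[OF Q] bilinear_rmul[OF Q] mult.assoc mult.left_commute)
  have "0 \<le> (\<Sum>i\<in>I. \<Sum>j\<in>I. Q (z i *\<^sub>R e j - z j *\<^sub>R e i) (z i *\<^sub>R e j - z j *\<^sub>R e i))"
    by (intro sum_nonneg psd)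
  also have "\<dots> = (\<Sum>i\<in>I. \<Sum>j\<in>I. (z i)\<^sup>2 * Q (e j) (e j) + (z j)\<^sup>2 * Q (e i) (e i)
      - z i * z j * Q (e i) (e j) - z j * z i * Q (e j) (e i))"
    by (intro sum.cong refl) (simp add: bilinear_lsub[OF Q] bilinear_rsub[OF Q] bilinear_lmul[OF Q]
        bilinear_rmul[OF Q] power2_eq_square algebra_simps)
  also have "\<dots> = (\<Sum>i\<in>I. \<Sum>j\<in>I. (z i)\<^sup>2 * Q (e j) (e j)) + (\<Sum>i\<in>I. \<Sum>j\<in>I. (z j)\<^sup>2 * Q (e i) (e i))
      - Q u u - (\<Sum>i\<in>I. \<Sum>j\<in>I. z j * z i * Q (e j) (e i))"
    by (simp add: u sum.distrib sum_subtractf)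
  also have "(\<Sum>i\<in>I. \<Sum>j\<in>I. z j * z i * Q (e j) (e i)) = Q u u"
    unfolding u by (rule sum.swap)
  also have "(\<Sum>i\<in>I. \<Sum>j\<in>I. (z j)\<^sup>2 * Q (e i) (e i)) = (\<Sum>i\<in>I. \<Sum>j\<in>I. (z i)\<^sup>2 * Q (e j) (e j))"
    by (rule sum.swap)
  also have "(\<Sum>i\<in>I. \<Sum>j\<in>I. (z i)\<^sup>2 * Q (e j) (e j)) = (\<Sum>i\<in>I. (z i)\<^sup>2) * (\<Sum>i\<in>I. Q (e i) (e i))"
    by (simp add: sum_product)
  finally show ?thesis unfolding u_def by (simp add: mult.commute)
qed

lemma matrix_inv_unique:
  fixes G :: "real^'n^'n"
  assumes "G ** X = mat 1"
  shows "matrix_inv G = X"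
proof -
  have "invertible G" using assms invertible_right_inverse by blast
  then have "matrix_inv G ** G = mat 1" unfolding matrix_inv_def invertible_def by (rule someI2_ex) simp
  then have "X = matrix_inv G ** (G ** X)" by (simp add: matrix_mul_assoc)
  then show ?thesis using assms by simp
qed

abbreviation minkowski :: "'n \<Rightarrow> real^'n^'n" where
  "minkowski k \<equiv> \<chi> i j. if i \<noteq> j then 0 else if i = k then 1 else - 1"

lemma minkowski_squared: "minkowski k ** minkowski k = mat 1"
proof -
  have "(\<Sum>l\<in>UNIV. (if i \<noteq> l then 0 else if i = k then 1 else - 1) *
      (if l \<noteq> j then 0 else if l = k then 1 else - 1)) = (if i = j then 1 else (0::real))" for i j
  proof -
    have "(\<Sum>l\<in>UNIV. (if i \<noteq> l then 0 else if i = k then 1 else - 1) *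
        (if l \<noteq> j then 0 else if l = k then 1 else - (1::real))) =
      (\<Sum>l\<in>UNIV. if l = i then (if i = j then 1 else 0) else 0)"
      by (intro sum.cong) auto
    then show ?thesis by simp
  qed
  then show ?thesis by (simp add: matrix_matrix_mult_def mat_def vec_eq_iff)
qed

text \<open>The normal form \<open>P\<^sup>T G P = D\<close> gives \<open>G\<^sup>-\<^sup>1 = P D\<^sup>-\<^sup>1 P\<^sup>T\<close>, and \<open>D\<close> is its own inverse.\<close>

lemma lorentzian_matrix_right_inverse:
  fixes G P :: "real^'n^'n"
  assumes P: "invertible P" and D: "transpose P ** G ** P = minkowski k"
  shows "G ** (P ** minkowski k ** transpose P) = mat 1"
proof -
  obtain R where R: "R ** P = mat 1" "P ** R = mat 1" using P unfolding invertible_def by blast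
  then have RT: "transpose R ** transpose P = mat 1"
    unfolding matrix_transpose_mul[symmetric] by simp
  have "transpose P ** (G ** (P ** minkowski k ** transpose P)) =
      transpose P ** G ** P ** minkowski k ** transpose P"
    by (simp only: matrix_mul_assoc)
  also have "\<dots> = transpose P" unfolding D minkowski_squared by (rule matrix_mul_lid)
  finally have "transpose P ** (G ** (P ** minkowski k ** transpose P)) = transpose P" .
  then have "transpose R ** (transpose P ** (G ** (P ** minkowski k ** transpose P))) = mat 1"
    using RT by simp
  then show "G ** (P ** minkowski k ** transpose P) = mat 1"
    unfolding matrix_mul_assoc RT matrix_mul_lid .
qed

lemma lorentzian_matrix_invertible: "lorentzian_matrix G \<Longrightarrow> invertible G"
  unfolding lorentzian_matrix_def invertible_right_inverse[of G]
  using lorentzian_matrix_right_inverse by blast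

lemma minkowski_entry_sum:
  fixes i k :: "'n::finite"
  shows "(\<Sum>j\<in>UNIV. (if i \<noteq> j then 0 else if i = k then 1 else - 1) * f j) = (if i = k then 1 else - 1) * (f i :: real)"
proof -
  have "(\<Sum>j\<in>UNIV. (if i \<noteq> j then 0 else if i = k then 1 else - 1) * f j) =
    (\<Sum>j\<in>UNIV. if j = i then (if i = k then 1 else - 1) * f i else 0)"
    by (intro sum.cong) auto
  also have "\<dots> = (if i = k then 1 else - 1) * f i" by (subst sum.delta) simp_all
  finally show ?thesis .
qed

lemma lorentzian_matrix_inv_entry:
  fixes G P :: "real^'n^'n"
  assumes P: "invertible P" and D: "transpose P ** G ** P = minkowski k"
  shows "matrix_inv G $ a $ b = (\<Sum>i\<in>UNIV. (if i = k then 1 else - 1) * (P $ a $ i * P $ b $ i))"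
proof -
  have "matrix_inv G = P ** (minkowski k ** transpose P)"
    using matrix_inv_unique[OF lorentzian_matrix_right_inverse[OF P D]] by (simp add: matrix_mul_assoc)
  moreover have "(minkowski k ** transpose P) $ i $ b = (if i = k then 1 else - 1) * P $ b $ i" for i
    by (simp only: matrix_matrix_mult_def vec_lambda_beta minkowski_entry_sum) (simp add: transpose_def)
  ultimately show ?thesis by (simp add: matrix_matrix_mult_def mult.left_commute)
qed

lemma lorentzian_matrix_inv_sym:
  fixes G :: "real^'n^'n"
  assumes "lorentzian_matrix G"
  shows "matrix_inv G $ a $ b = matrix_inv G $ b $ a"
proof -
  obtain P :: "real^'n^'n" and k where P: "invertible P" "transpose P ** G ** P = minkowski k"
    using assms unfolding lorentzian_matrix_def by blast
  then show ?thesis unfolding lorentzian_matrix_inv_entry[OF P] by (simp add: mult.commute)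
qed

text \<open>In a \<open>G\<close>-orthonormal basis \<open>e\<close>, with \<open>e\<^sub>k\<close> timelike and \<open>Q = - H\<close>, the trace is
  \<open>\<Sum>\<^sub>i Q(e\<^sub>i, e\<^sub>i) - Q(e\<^sub>k, e\<^sub>k)\<close>, summed over \<open>i \<noteq> k\<close>. Since \<open>y = z\<^sub>k e\<^sub>k + u\<close> is isotropic for \<open>Q\<close>, the
  vectors \<open>z\<^sub>k e\<^sub>k\<close> and \<open>u\<close> have the same value of \<open>Q\<close>; and \<open>Q(u, u)\<close> is at most \<open>\<Sum>\<^sub>i z\<^sub>i\<^sup>2\<close> times the
  first sum. That \<open>y\<close> is timelike means exactly that \<open>\<Sum>\<^sub>i z\<^sub>i\<^sup>2 < z\<^sub>k\<^sup>2\<close>.\<close>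

lemma lorentzian_trace_nonneg:
  fixes G H :: "real^'n^'n"
  assumes G: "lorentzian_matrix G" and timelike: "y \<bullet> (G *v y) > 0"
    and nsd: "\<And>w. w \<bullet> (H *v w) \<le> 0" and null: "y \<bullet> (H *v y) = 0"
  shows "(\<Sum>a\<in>UNIV. \<Sum>b\<in>UNIV. matrix_inv G $ a $ b * H $ a $ b) \<ge> 0"
proof -
  obtain P :: "real^'n^'n" and k where P: "invertible P" and D: "transpose P ** G ** P = minkowski k"
    using G unfolding lorentzian_matrix_def by blast
  define Q where "Q u v = - (u \<bullet> (H *v v))" for u v
  have Q: "bilinear Q"
    unfolding Q_def bilinear_def
    by (auto intro!: linearI simp: inner_add_left inner_add_right matrix_vector_right_distrib
        matrix_vector_mult_scaleR)
  have psd: "Q w w \<ge> 0" for w using nsd by (simp add: Q_def)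
  define e where "e i = column i P" for i
  define z where "z = matrix_inv P *v y"
  have "P ** matrix_inv P = mat 1"
    using P unfolding matrix_inv_def invertible_def by (rule someI2_ex) simp
  then have Pz: "y = P *v z" unfolding z_def matrix_vector_mul_assoc by simp
  have yk: "y = (\<Sum>i\<in>UNIV. z $ i *\<^sub>R e i)"
    unfolding Pz e_def by (simp add: matrix_mult_sum scalar_mult_eq_scaleR)
  define I where "I = UNIV - {k}"
  have U: "(\<Sum>i\<in>UNIV. f i) = f k + (\<Sum>i\<in>I. f i)" for f :: "'n \<Rightarrow> 'b::ab_group_add"
    unfolding I_def by (rule sum.remove) auto
  define u where "u = (\<Sum>i\<in>I. z $ i *\<^sub>R e i)"
  have "y \<bullet> (G *v y) = z \<bullet> (minkowski k *v z)"
  proof -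
    have "(P *v z) \<bullet> w = z \<bullet> (transpose P *v w)" for w
      by (simp only: dot_lmul_matrix[symmetric] vector_transpose_matrix)
    then show ?thesis unfolding Pz D[symmetric] by (simp only: matrix_vector_mul_assoc matrix_mul_assoc)
  qed
  also have "\<dots> = (z $ k)\<^sup>2 - (\<Sum>i\<in>I. (z $ i)\<^sup>2)"
    unfolding inner_vec_def matrix_vector_mult_def vec_lambda_beta minkowski_entry_sum U
    by (simp add: I_def power2_eq_square sum_negf)
  finally have z: "(\<Sum>i\<in>I. (z $ i)\<^sup>2) < (z $ k)\<^sup>2" using timelike by simp
  have tr: "(\<Sum>a\<in>UNIV. \<Sum>b\<in>UNIV. matrix_inv G $ a $ b * H $ a $ b) = (\<Sum>i\<in>I. Q (e i) (e i)) - Q (e k) (e k)"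
  proof -
    have "(\<Sum>a\<in>UNIV. \<Sum>b\<in>UNIV. matrix_inv G $ a $ b * H $ a $ b)
      = (\<Sum>a\<in>UNIV. \<Sum>b\<in>UNIV. \<Sum>i\<in>UNIV. (if i = k then 1 else - 1) * (P $ a $ i * P $ b $ i) * H $ a $ b)"
      unfolding lorentzian_matrix_inv_entry[OF P D] by (simp add: sum_distrib_right)
    also have "\<dots> = (\<Sum>a\<in>UNIV. \<Sum>i\<in>UNIV. \<Sum>b\<in>UNIV. (if i = k then 1 else - 1) * (P $ a $ i * P $ b $ i) * H $ a $ b)"
      by (intro sum.cong refl sum.swap)
    also have "\<dots> = (\<Sum>i\<in>UNIV. \<Sum>a\<in>UNIV. \<Sum>b\<in>UNIV. (if i = k then 1 else - 1) * (P $ a $ i * P $ b $ i) * H $ a $ b)"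
      by (rule sum.swap)
    also have "\<dots> = (\<Sum>i\<in>UNIV. (if i = k then 1 else - 1) * - Q (e i) (e i))"
      by (intro sum.cong refl)
        (simp add: Q_def e_def column_def inner_vec_def matrix_vector_mult_def sum_distrib_left sum_negf mult_ac)
    also have "\<dots> = (\<Sum>i\<in>I. Q (e i) (e i)) - Q (e k) (e k)"
      unfolding U by (simp add: I_def sum_negf)
    finally show ?thesis .
  qed
  have ek: "z $ k *\<^sub>R e k = y - u" unfolding yk u_def U by simp
  have "(z $ k)\<^sup>2 * Q (e k) (e k) = Q (z $ k *\<^sub>R e k) (z $ k *\<^sub>R e k)"
    by (simp add: bilinear_lmul[OF Q] bilinear_rmul[OF Q] power2_eq_square)
  also have "\<dots> = Q y y + Q u u - (Q y u + Q u y)"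
    unfolding ek by (simp add: bilinear_lsub[OF Q] bilinear_rsub[OF Q])
  also have "\<dots> = Q u u"
    using psd_isotropic_cross[OF Q psd, of y u] null by (simp add: Q_def)
  also have "\<dots> \<le> (\<Sum>i\<in>I. (z $ i)\<^sup>2) * (\<Sum>i\<in>I. Q (e i) (e i))"
    unfolding u_def by (rule psd_sum_le[OF Q psd]) simp
  also have "\<dots> \<le> (z $ k)\<^sup>2 * (\<Sum>i\<in>I. Q (e i) (e i))"
    using z by (intro mult_right_mono sum_nonneg psd) simp
  finally have "(z $ k)\<^sup>2 * Q (e k) (e k) \<le> (z $ k)\<^sup>2 * (\<Sum>i\<in>I. Q (e i) (e i))" .
  moreover have "(z $ k)\<^sup>2 > 0" using z by (smt (verit) sum_nonneg zero_le_power2)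
  ultimately show ?thesis unfolding tr by simp
qed

section \<open>Homogeneous functions and Hessians\<close>

lemma frechet_derivative_expand:
  fixes f :: "real^'n \<Rightarrow> real"
  assumes "f differentiable (at x)"
  shows "frechet_derivative f (at x) w = (\<Sum>a\<in>UNIV. w $ a * pderiv_at a f x)"
proof -
  have lin: "linear (frechet_derivative f (at x))"
    using assms by (simp add: linear_frechet_derivative)
  have "frechet_derivative f (at x) w = frechet_derivative f (at x) (\<Sum>a\<in>UNIV. w $ a *\<^sub>R axis a 1)"
    using basis_expansion[of w] by (simp add: scalar_mult_eq_scaleR)
  then show ?thesis by (simp add: linear_sum[OF lin] linear_scale[OF lin] pderiv_at_def)
qed

text \<open>The chain rule for \<open>f \<circ> T = c f\<close>. With \<open>T\<close> a dilation of the whole space or of the fibres only, it gives the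
  homogeneity degrees of all partial derivatives.\<close>

lemma frechet_derivative_homogeneous:
  fixes f :: "'a::real_normed_vector \<Rightarrow> real"
  assumes S: "open S" "z \<in> S" and T: "bounded_linear T" and f: "\<And>w. w \<in> S \<Longrightarrow> f (T w) = c * f w"
    and d: "f differentiable (at z)" "f differentiable (at (T z))"
  shows "frechet_derivative f (at (T z)) (T v) = c * frechet_derivative f (at z) v"
proof -
  have "((\<lambda>w. f (T w)) has_derivative (\<lambda>v. frechet_derivative f (at (T z)) (T v))) (at z)"
    using has_derivative_compose[OF bounded_linear_imp_has_derivative[OF T], of f _ z UNIV] d(2)
    by (simp add: frechet_derivative_works)
  then have "((\<lambda>w. c * f w) has_derivative (\<lambda>v. frechet_derivative f (at (T z)) (T v))) (at z)"
    by (rule has_derivative_transform_within_open[OF _ S]) (simp add: f)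
  moreover have "((\<lambda>w. c * f w) has_derivative (\<lambda>v. c * frechet_derivative f (at z) v)) (at z)"
    using d(1) by (intro has_derivative_mult_right) (simp add: frechet_derivative_works)
  ultimately show ?thesis using has_derivative_unique by (metis (no_types, lifting))
qed

lemma smooth_on_differentiable: "smooth_on S f \<Longrightarrow> x \<in> S \<Longrightarrow> f differentiable (at x)"
  using smooth_on_has_derivative differentiable_def by blast

lemma smooth_on_line_derivative:
  fixes f :: "real^'n \<Rightarrow> real"
  assumes "smooth_on B f" "y + t *\<^sub>R w \<in> B"
  shows "((\<lambda>t. f (y + t *\<^sub>R w)) has_real_derivative (\<Sum>a\<in>UNIV. w $ a * pderiv_at a f (y + t *\<^sub>R w))) (at t)"
proof -
  note d = smooth_on_differentiable[OF assms]
  have "((\<lambda>t. y + t *\<^sub>R w) has_derivative (\<lambda>s. s *\<^sub>R w)) (at t)"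
    by (auto intro!: derivative_eq_intros)
  then have "((\<lambda>t. f (y + t *\<^sub>R w)) has_derivative (\<lambda>s. frechet_derivative f (at (y + t *\<^sub>R w)) (s *\<^sub>R w))) (at t)"
    using has_derivative_compose[of "\<lambda>t. y + t *\<^sub>R w" _ t UNIV f] d
    by (simp add: frechet_derivative_works)
  moreover have "frechet_derivative f (at (y + t *\<^sub>R w)) (s *\<^sub>R w) =
      (\<Sum>a\<in>UNIV. w $ a * pderiv_at a f (y + t *\<^sub>R w)) * s" for s
    unfolding frechet_derivative_expand[OF d] by (simp add: sum_distrib_left sum_distrib_right mult_ac)
  ultimately show ?thesis by (simp add: has_field_derivative_def)
qed

lemma euler_homogeneous:
  fixes f :: "real^'n \<Rightarrow> real"
  assumes f: "smooth_on B f" and y: "y \<in> B" and hom: "\<And>t. t > 0 \<Longrightarrow> f (t *\<^sub>R y) = t ^ k * f y"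
  shows "(\<Sum>a\<in>UNIV. y $ a * pderiv_at a f y) = real k * f y"
proof -
  have "((\<lambda>t. f (t *\<^sub>R y)) has_real_derivative (\<Sum>a\<in>UNIV. y $ a * pderiv_at a f y)) (at 1)"
    using smooth_on_line_derivative[OF f, of 0 1 y] y by simp
  then have "((\<lambda>t. t ^ k * f y) has_real_derivative (\<Sum>a\<in>UNIV. y $ a * pderiv_at a f y)) (at 1)"
    by (rule DERIV_cong_ev[THEN iffD1, rotated -1])
      (auto simp: hom intro!: eventually_mono[OF eventually_nhds_in_open[of "{0<..}"]])
  moreover have "((\<lambda>t. t ^ k * f y) has_real_derivative real k * f y) (at 1)"
    by (auto intro!: derivative_eq_intros)
  ultimately show ?thesis by (rule DERIV_unique)
qed

lemma pderiv_at_mult: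
  assumes "f differentiable (at x)" "g differentiable (at x)"
  shows "pderiv_at a (\<lambda>x. f x * g x) x = pderiv_at a f x * g x + f x * pderiv_at a g x"
proof -
  have "((\<lambda>x. f x * g x) has_derivative
      (\<lambda>v. f x * frechet_derivative g (at x) v + frechet_derivative f (at x) v * g x)) (at x)"
    using assms by (intro has_derivative_mult) (simp_all add: frechet_derivative_works)
  then show ?thesis unfolding pderiv_at_def by (simp add: frechet_derivative_at[symmetric])
qed

lemma pderiv_at_add:
  assumes "f differentiable (at x)" "g differentiable (at x)"
  shows "pderiv_at a (\<lambda>x. f x + g x) x = pderiv_at a f x + pderiv_at a g x"
proof -
  have "((\<lambda>x. f x + g x) has_derivative
      (\<lambda>v. frechet_derivative f (at x) v + frechet_derivative g (at x) v)) (at x)"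
    using assms by (intro has_derivative_add) (simp_all add: frechet_derivative_works)
  then show ?thesis unfolding pderiv_at_def by (simp add: frechet_derivative_at[symmetric])
qed

lemma pderiv_at_cong_open:
  "open S \<Longrightarrow> x \<in> S \<Longrightarrow> (\<And>y. y \<in> S \<Longrightarrow> f y = g y) \<Longrightarrow> pderiv_at a f x = pderiv_at a g x"
  unfolding pderiv_at_def using frechet_derivative_cong_open[of S x f g] by simp

definition hessian :: "(real^'n \<Rightarrow> real) \<Rightarrow> real^'n \<Rightarrow> real^'n^'n" where
  "hessian f y = (\<chi> a b. pderiv_at b (pderiv_at a f) y)"

lemma hessian_cong_open:
  assumes "open S" "x \<in> S" "\<And>y. y \<in> S \<Longrightarrow> f y = g y"
  shows "hessian f x = hessian g x"
  unfolding hessian_def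
  using pderiv_at_cong_open[OF assms(1,2), of "pderiv_at a f" "pderiv_at a g" for a]
    pderiv_at_cong_open[OF assms(1) _ assms(3)] by (simp add: vec_eq_iff)

lemma smooth_on_hessian: "smooth_on S f \<Longrightarrow> smooth_on S (\<lambda>y. hessian f y $ a $ b)"
  unfolding hessian_def by (simp add: smooth_on_pderiv_at)

lemma hessian_mult:
  assumes B: "open B" "y \<in> B" and f: "smooth_on B f" and g: "smooth_on B g"
  shows "hessian (\<lambda>x. f x * g x) y $ a $ b =
    hessian f y $ a $ b * g y + pderiv_at a f y * pderiv_at b g y + pderiv_at b f y * pderiv_at a g y
    + f y * hessian g y $ a $ b"
proof -
  note d = smooth_on_differentiable
  have "pderiv_at b (pderiv_at a (\<lambda>x. f x * g x)) y =
      pderiv_at b (\<lambda>x. pderiv_at a f x * g x + f x * pderiv_at a g x) y"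
    by (rule pderiv_at_cong_open[OF B]) (intro pderiv_at_mult d[OF f] d[OF g])
  also have "\<dots> = pderiv_at b (\<lambda>x. pderiv_at a f x * g x) y + pderiv_at b (\<lambda>x. f x * pderiv_at a g x) y"
    by (intro pderiv_at_add d[OF smooth_on_mult[OF B(1)] B(2)] smooth_on_pderiv_at f g)
  also have "\<dots> = (pderiv_at b (pderiv_at a f) y * g y + pderiv_at a f y * pderiv_at b g y)
      + (pderiv_at b f y * pderiv_at a g y + f y * pderiv_at b (pderiv_at a g) y)"
    using B by (intro arg_cong2[where f = "(+)"] pderiv_at_mult d[of B] smooth_on_pderiv_at f g)
  finally show ?thesis by (simp add: hessian_def)
qed

lemma hessian_cmult:
  assumes "open B" "y \<in> B" "smooth_on B f"
  shows "hessian (\<lambda>x. c * f x) y $ a $ b = c * hessian f y $ a $ b"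
proof -
  have 0: "pderiv_at a (\<lambda>_. c::real) = (\<lambda>_. 0)" for a :: "'a" and c
    by (simp add: pderiv_at_def[abs_def] frechet_derivative_const)
  show ?thesis using hessian_mult[OF assms(1,2) smooth_on_const[OF assms(1)] assms(3), of c a b]
    by (simp add: 0 hessian_def)
qed

lemma hessian_quadratic_form:
  "w \<bullet> (hessian f y *v w) = (\<Sum>a\<in>UNIV. w $ a * (\<Sum>b\<in>UNIV. w $ b * pderiv_at b (pderiv_at a f) y))"
  by (simp add: inner_vec_def matrix_vector_mult_def hessian_def mult.commute)

lemma smooth_on_line_derivative2:
  fixes f :: "real^'n \<Rightarrow> real"
  assumes f: "smooth_on B f" and y: "y \<in> B"
  shows "((\<lambda>t. \<Sum>a\<in>UNIV. w $ a * pderiv_at a f (y + t *\<^sub>R w)) has_real_derivative w \<bullet> (hessian f y *v w)) (at 0)"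
proof -
  have "((\<lambda>t. pderiv_at a f (y + t *\<^sub>R w)) has_real_derivative
      (\<Sum>b\<in>UNIV. w $ b * pderiv_at b (pderiv_at a f) y)) (at 0)" for a
    using smooth_on_line_derivative[OF smooth_on_pderiv_at[OF f, of a], of y 0 w] y by simp
  then show ?thesis unfolding hessian_quadratic_form by (intro DERIV_sum DERIV_cmult)
qed

text \<open>If the second derivative along a line were positive, the first derivative, which is zero at the maximum, would be
  positive shortly after it, and the function would exceed its maximum.\<close>

lemma hessian_nonpos_at_maximum:
  fixes f :: "real^'n \<Rightarrow> real"
  assumes B: "open B" "y \<in> B" and f: "smooth_on B f" and max: "\<And>z. z \<in> B \<Longrightarrow> f z \<le> f y"
  shows "w \<bullet> (hessian f y *v w) \<le> 0"
proof (rule ccontr)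
  define F where "F t = f (y + t *\<^sub>R w)" for t
  define F' where "F' t = (\<Sum>a\<in>UNIV. w $ a * pderiv_at a f (y + t *\<^sub>R w))" for t
  assume "\<not> w \<bullet> (hessian f y *v w) \<le> 0"
  moreover have "(F' has_real_derivative w \<bullet> (hessian f y *v w)) (at 0)"
    unfolding F'_def[abs_def] by (rule smooth_on_line_derivative2[OF f B(2)])
  ultimately obtain d where d: "d > 0" "\<And>h. 0 < h \<Longrightarrow> h < d \<Longrightarrow> F' 0 < F' h"
    using DERIV_pos_inc_right[of F' "w \<bullet> (hessian f y *v w)" 0] unfolding add_0 not_le by blast
  have "open ((\<lambda>t. y + t *\<^sub>R w) -` B)"
    using B(1) by (intro open_vimage continuous_intros)
  moreover have "0 \<in> (\<lambda>t. y + t *\<^sub>R w) -` B" using B(2) by simp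
  ultimately obtain e where e: "e > 0" "ball 0 e \<subseteq> (\<lambda>t. y + t *\<^sub>R w) -` B" by (meson openE)
  then have inB: "y + t *\<^sub>R w \<in> B" if "\<bar>t\<bar> < e" for t using that by (auto simp: subset_iff)
  then have F: "(F has_real_derivative F' t) (at t)" if "\<bar>t\<bar> < e" for t
    using smooth_on_line_derivative[OF f, of y t w] that by (simp add: F_def[abs_def] F'_def)
  have F0: "F t \<le> F 0" if "\<bar>t\<bar> < e" for t using max[OF inB[OF that]] by (simp add: F_def)
  have "F' 0 = 0" using DERIV_local_max[OF F[of 0] e(1)] F0 e(1) by simp
  define t where "t = min d e / 2"
  have t: "0 < t" "t < d" "t < e" using d e by (auto simp: t_def)
  obtain s where "0 < s" "s < t" "F t - F 0 = (t - 0) * F' s"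
    using MVT2[OF t(1), of F F'] F t by fastforce
  moreover have "F' s > 0" using d(2)[of s] \<open>F' 0 = 0\<close> calculation t by simp
  ultimately show False using F0[of t] t by (smt (verit) mult_pos_pos)
qed

text \<open>A \<open>0\<close>-homogeneous function is constant along the ray through \<open>y\<close>, so the second derivative in that direction
  vanishes.\<close>

lemma hessian_null_homogeneous:
  fixes f :: "real^'n \<Rightarrow> real"
  assumes B: "open B" "\<And>x t. x \<in> B \<Longrightarrow> t > 0 \<Longrightarrow> t *\<^sub>R x \<in> B" and y: "y \<in> B" and f: "smooth_on B f"
    and hom: "\<And>x t. x \<in> B \<Longrightarrow> t > 0 \<Longrightarrow> f (t *\<^sub>R x) = f x"
  shows "y \<bullet> (hessian f y *v y) = 0"
proof -
  have "(\<Sum>a\<in>UNIV. y $ a * pderiv_at a f (y + t *\<^sub>R y)) = 0" if t: "\<bar>t\<bar> < 1" for t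
  proof -
    define x where "x = (1 + t) *\<^sub>R y"
    have pos: "1 + t > 0" using t by simp
    then have x: "x \<in> B" using B(2) y by (simp add: x_def)
    have "(\<Sum>a\<in>UNIV. x $ a * pderiv_at a f x) = 0"
      using euler_homogeneous[OF f x, of 0] hom[OF x] by simp
    then have "(1 + t) * (\<Sum>a\<in>UNIV. y $ a * pderiv_at a f x) = 0"
      by (simp add: x_def sum_distrib_left mult.assoc)
    moreover have "x = y + t *\<^sub>R y" by (simp add: x_def scaleR_left_distrib)
    ultimately show ?thesis using pos by simp
  qed
  then have "((\<lambda>t. 0) has_real_derivative y \<bullet> (hessian f y *v y)) (at 0)"
    by (intro DERIV_cong_ev[THEN iffD1, OF refl _ refl smooth_on_line_derivative2[OF f y]])
      (auto intro!: eventually_mono[OF eventually_nhds_in_open[of "ball 0 1"]])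
  then show ?thesis using DERIV_const DERIV_unique by blast
qed

section \<open>Rigidity on a Lorentzian cone\<close>

text \<open>This is the fundamental tensor \<open>g\<close> of \<open>L\<close> on a single fibre.\<close>

definition half_hessian :: "(real^'n \<Rightarrow> real) \<Rightarrow> real^'n \<Rightarrow> real^'n^'n" where
  "half_hessian L y = (\<chi> a b. hessian L y $ a $ b / 2)"

text \<open>In index notation \<open>g\<^sup>a\<^sup>b f\<^sub>\<cdot>\<^sub>a\<^sub>\<cdot>\<^sub>b\<close>, with \<open>g\<close> the fundamental tensor of \<open>L\<close>.\<close>

definition metric_trace :: "(real^'n \<Rightarrow> real) \<Rightarrow> (real^'n \<Rightarrow> real) \<Rightarrow> real^'n \<Rightarrow> real" where
  "metric_trace L f y =
    (\<Sum>a\<in>UNIV. \<Sum>b\<in>UNIV. matrix_inv (half_hessian L y) $ a $ b * hessian f y $ a $ b)"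

lemma pderiv_at_homogeneous:
  fixes f :: "real^'n \<Rightarrow> real"
  assumes B: "open B" "\<And>x t. x \<in> B \<Longrightarrow> t > 0 \<Longrightarrow> t *\<^sub>R x \<in> B" and f: "smooth_on B f"
    and hom: "\<And>x t. x \<in> B \<Longrightarrow> t > 0 \<Longrightarrow> f (t *\<^sub>R x) = t ^ Suc k * f x"
    and x: "x \<in> B" and t: "t > 0"
  shows "pderiv_at a f (t *\<^sub>R x) = t ^ k * pderiv_at a f x"
proof -
  note d = smooth_on_differentiable[OF f]
  have "frechet_derivative f (at (t *\<^sub>R x)) (t *\<^sub>R axis a 1) = t ^ Suc k * frechet_derivative f (at x) (axis a 1)"
    using B(2)[OF x t] by (intro frechet_derivative_homogeneous[OF B(1) x] bounded_linear_scaleR_right d x)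
      (simp_all add: hom t)
  moreover have "frechet_derivative f (at (t *\<^sub>R x)) (t *\<^sub>R axis a 1) = t * pderiv_at a f (t *\<^sub>R x)"
    using linear_frechet_derivative[OF d[OF B(2)[OF x t]]] by (simp add: linear_scale pderiv_at_def)
  ultimately show ?thesis using t by (simp add: pderiv_at_def)
qed

text \<open>Euler's relation for the degree \<open>1\<close> functions \<open>L\<^sub>\<cdot>\<^sub>a\<close> and for \<open>L\<close> itself: \<open>g\<^sub>a\<^sub>b y\<^sup>b = L\<^sub>\<cdot>\<^sub>a / 2\<close> and
  \<open>g\<^sub>a\<^sub>b y\<^sup>a y\<^sup>b = L\<close>.\<close>

lemma half_hessian_euler:
  fixes L :: "real^'n \<Rightarrow> real"
  assumes B: "open B" "\<And>x t. x \<in> B \<Longrightarrow> t > 0 \<Longrightarrow> t *\<^sub>R x \<in> B" and L: "smooth_on B L"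
    and hom: "\<And>x t. x \<in> B \<Longrightarrow> t > 0 \<Longrightarrow> L (t *\<^sub>R x) = t\<^sup>2 * L x" and y: "y \<in> B"
  shows "(half_hessian L y *v y) $ a = pderiv_at a L y / 2" and "y \<bullet> (half_hessian L y *v y) = L y"
proof -
  have "(\<Sum>b\<in>UNIV. y $ b * pderiv_at b (pderiv_at a L) y) = pderiv_at a L y" for a
    using euler_homogeneous[OF smooth_on_pderiv_at[OF L] y, of a 1]
      pderiv_at_homogeneous[OF B L, of 1 y _ a] y hom by (simp add: power2_eq_square)
  then show 1: "(half_hessian L y *v y) $ a = pderiv_at a L y / 2" for a
    by (simp add: matrix_vector_mult_def half_hessian_def hessian_def sum_divide_distrib[symmetric] mult.commute)
  have "(\<Sum>a\<in>UNIV. y $ a * pderiv_at a L y) = 2 * L y"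
    using euler_homogeneous[OF L y, of 2] hom[OF y] by simp
  then show "y \<bullet> (half_hessian L y *v y) = L y"
    by (simp add: inner_vec_def 1 sum_divide_distrib[symmetric])
qed

text \<open>In the trace of the product rule, \<open>g\<^sup>a\<^sup>b L\<^sub>\<cdot>\<^sub>a\<^sub>\<cdot>\<^sub>b = 2 n\<close> because \<open>L\<^sub>\<cdot>\<^sub>a\<^sub>\<cdot>\<^sub>b = 2 g\<^sub>a\<^sub>b\<close>, and the cross
  terms vanish: \<open>g\<^sup>a\<^sup>b L\<^sub>\<cdot>\<^sub>a = 2 y\<^sup>b\<close>, and \<open>y\<^sup>b S\<^sub>\<cdot>\<^sub>b = 0\<close> by Euler's relation.\<close>

lemma metric_trace_mult:
  fixes L S :: "real^'n \<Rightarrow> real"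
  assumes B: "open B" "\<And>x t. x \<in> B \<Longrightarrow> t > 0 \<Longrightarrow> t *\<^sub>R x \<in> B" and y: "y \<in> B"
    and L: "smooth_on B L" and L2: "\<And>x t. x \<in> B \<Longrightarrow> t > 0 \<Longrightarrow> L (t *\<^sub>R x) = t\<^sup>2 * L x"
    and S: "smooth_on B S" and S0: "\<And>x t. x \<in> B \<Longrightarrow> t > 0 \<Longrightarrow> S (t *\<^sub>R x) = S x"
    and lor: "lorentzian_matrix (half_hessian L y)"
  shows "metric_trace L (\<lambda>x. L x * S x) y = 2 * real CARD('n) * S y + L y * metric_trace L S y"
proof -
  define G where "G = half_hessian L y"
  define g where "g = matrix_inv G"
  have G: "invertible G" using lor lorentzian_matrix_invertible by (simp add: G_def)
  then have gG: "g ** G = mat 1" unfolding g_def matrix_inv_def invertible_def by (rule someI2_ex) simp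
  have sym: "g $ a $ b = g $ b $ a" for a b
    unfolding g_def G_def by (rule lorentzian_matrix_inv_sym[OF lor])
  have Ga: "pderiv_at a L y = 2 * (G *v y) $ a" for a
    using half_hessian_euler(1)[OF B L L2 y, of a] by (simp add: G_def)
  have "(\<Sum>a\<in>UNIV. \<Sum>b\<in>UNIV. g $ a $ b * hessian L y $ a $ b) = 2 * (\<Sum>a\<in>UNIV. \<Sum>b\<in>UNIV. g $ b $ a * G $ a $ b)"
    by (simp add: sum_distrib_left G_def half_hessian_def sym)
  also have "\<dots> = 2 * (\<Sum>b\<in>UNIV. (g ** G) $ b $ b)"
    by (subst sum.swap) (simp add: matrix_matrix_mult_def)
  also have "\<dots> = 2 * real CARD('n)" by (simp add: gG mat_def)
  finally have tr: "(\<Sum>a\<in>UNIV. \<Sum>b\<in>UNIV. g $ a $ b * hessian L y $ a $ b) = 2 * real CARD('n)" .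
  have "(\<Sum>a\<in>UNIV. g $ b $ a * (G *v y) $ a) = y $ b" for b
  proof -
    have "g *v (G *v y) = y" by (simp add: matrix_vector_mul_assoc gG)
    then show ?thesis by (metis (no_types, lifting) matrix_vector_mult_def sum.cong vec_lambda_beta)
  qed
  then have raise: "(\<Sum>a\<in>UNIV. g $ b $ a * pderiv_at a L y) = 2 * y $ b" for b
    unfolding Ga by (simp add: mult.left_commute sum_distrib_left[symmetric])
  have S1: "(\<Sum>b\<in>UNIV. y $ b * pderiv_at b S y) = 0"
    using euler_homogeneous[OF S y, of 0] S0[OF y] by simp
  have cross: "(\<Sum>b\<in>UNIV. \<Sum>a\<in>UNIV. g $ b $ a * (pderiv_at a L y * pderiv_at b S y)) = 0"
  proof -
    have "(\<Sum>b\<in>UNIV. \<Sum>a\<in>UNIV. g $ b $ a * (pderiv_at a L y * pderiv_at b S y)) =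
      (\<Sum>b\<in>UNIV. (\<Sum>a\<in>UNIV. g $ b $ a * pderiv_at a L y) * pderiv_at b S y)"
      by (simp add: sum_distrib_right mult.assoc)
    also have "\<dots> = 2 * (\<Sum>b\<in>UNIV. y $ b * pderiv_at b S y)"
      unfolding raise by (simp add: sum_distrib_left mult.assoc)
    finally show ?thesis using S1 by simp
  qed
  then have cross': "(\<Sum>a\<in>UNIV. \<Sum>b\<in>UNIV. g $ a $ b * (pderiv_at a L y * pderiv_at b S y)) = 0"
    by (subst sum.swap) (simp add: sym)
  have "metric_trace L (\<lambda>x. L x * S x) y = (\<Sum>a\<in>UNIV. \<Sum>b\<in>UNIV.
      S y * (g $ a $ b * hessian L y $ a $ b) + g $ a $ b * (pderiv_at a L y * pderiv_at b S y)
      + g $ a $ b * (pderiv_at b L y * pderiv_at a S y) + L y * (g $ a $ b * hessian S y $ a $ b))"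
    unfolding metric_trace_def G_def[symmetric] g_def[symmetric]
    by (intro sum.cong refl) (simp add: hessian_mult[OF B(1) y L S] algebra_simps)
  also have "\<dots> = S y * (2 * real CARD('n)) + 0 + 0 + L y * metric_trace L S y"
    unfolding metric_trace_def G_def[symmetric] g_def[symmetric]
    by (simp only: sum.distrib cross cross' tr sum_distrib_left[symmetric])
  finally show ?thesis by simp
qed

lemma metric_trace_cmult:
  assumes "open B" "y \<in> B" "smooth_on B f"
  shows "metric_trace L (\<lambda>x. c * f x) y = c * metric_trace L f y"
  unfolding metric_trace_def hessian_cmult[OF assms] by (simp add: sum_distrib_left mult.left_commute)

lemma metric_trace_cong_open:
  assumes "open B" "y \<in> B" "\<And>x. x \<in> B \<Longrightarrow> f x = h x"
  shows "metric_trace L f y = metric_trace L h y"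
  unfolding metric_trace_def using hessian_cong_open[OF assms] by simp

lemma metric_trace_nonneg_at_maximum:
  fixes L S :: "real^'n \<Rightarrow> real"
  assumes B: "open B" "\<And>x t. x \<in> B \<Longrightarrow> t > 0 \<Longrightarrow> t *\<^sub>R x \<in> B" and y: "y \<in> B"
    and L: "smooth_on B L" and L2: "\<And>x t. x \<in> B \<Longrightarrow> t > 0 \<Longrightarrow> L (t *\<^sub>R x) = t\<^sup>2 * L x"
    and S: "smooth_on B S" and S0: "\<And>x t. x \<in> B \<Longrightarrow> t > 0 \<Longrightarrow> S (t *\<^sub>R x) = S x"
    and lor: "lorentzian_matrix (half_hessian L y)" and pos: "L y > 0"
    and max: "\<And>x. x \<in> B \<Longrightarrow> S x \<le> S y"
  shows "metric_trace L S y \<ge> 0"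
  unfolding metric_trace_def
  by (rule lorentzian_trace_nonneg[OF lor, of y])
    (use pos half_hessian_euler(2)[OF B L L2 y] in
      \<open>auto intro: hessian_nonpos_at_maximum[OF B(1) y S max] hessian_null_homogeneous[OF B y S S0]\<close>)

text \<open>A positive value of \<open>f\<close> would give \<open>S = f / L\<close> a positive maximum inside the cone, where the equation for
  \<open>S\<close> makes its trace negative although the maximum makes it nonnegative.\<close>

lemma lorentzian_cone_nonpos:
  fixes L f :: "real^'n \<Rightarrow> real"
  assumes n: "CARD('n) \<ge> 3"
    and B: "open B" "\<And>x t. x \<in> B \<Longrightarrow> t > 0 \<Longrightarrow> t *\<^sub>R x \<in> B" and B0: "0 \<notin> B"
    and W: "open W" "closure B - {0} \<subseteq> W" and L: "smooth_on W L" and f: "smooth_on W f"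
    and L2: "\<And>x t. x \<in> B \<Longrightarrow> t > 0 \<Longrightarrow> L (t *\<^sub>R x) = t\<^sup>2 * L x"
    and f2: "\<And>x t. x \<in> B \<Longrightarrow> t > 0 \<Longrightarrow> f (t *\<^sub>R x) = t\<^sup>2 * f x"
    and pos: "\<And>x. x \<in> B \<Longrightarrow> L x > 0"
    and lor: "\<And>x. x \<in> B \<Longrightarrow> lorentzian_matrix (half_hessian L x)"
    and bd: "\<And>x. x \<in> closure B \<Longrightarrow> x \<noteq> 0 \<Longrightarrow> x \<notin> B \<Longrightarrow> L x = 0 \<and> invertible (half_hessian L x)"
    and pde: "\<And>x. x \<in> B \<Longrightarrow> (real CARD('n) + 2) * f x = L x * metric_trace L f x"
    and y: "y \<in> B"
  shows "f y \<le> 0"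
proof (rule ccontr)
  assume fy: "\<not> f y \<le> 0"
  define n where "n = real CARD('n)"
  have n3: "n \<ge> 3" using n by (simp add: n_def)
  define S where "S x = inverse (n + 2) * metric_trace L f x" for x
  \<comment> \<open>On \<open>V\<close> the inverse matrix, and therefore \<open>S\<close>, is smooth; it contains the closed cone without its apex.\<close>
  define V where "V = W \<inter> (\<lambda>x. det (half_hessian L x)) -` (- {0})"
  have GW: "smooth_on W (\<lambda>x. half_hessian L x $ a $ b)" for a b
    unfolding half_hessian_def using smooth_on_mult[OF W(1) smooth_on_hessian[OF L, of a b] smooth_on_const[OF W(1), of "1/2"]]
    by simp
  have V: "open V"
    unfolding V_def by (intro continuous_open_preimage smooth_on_open_continuous smooth_on_det W GW) auto
  have VW: "V \<subseteq> W" by (auto simp: V_def)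
  have BW: "B \<subseteq> W" using W(2) B0 closure_subset[of B] by blast
  have BV: "B \<subseteq> V"
    using lorentzian_matrix_invertible[OF lor] BW by (auto simp: V_def invertible_det_nz)
  have clV: "closure B - {0} \<subseteq> V"
    using bd W(2) BV unfolding V_def invertible_det_nz by blast
  have SV: "smooth_on V S"
    unfolding S_def metric_trace_def
    by (intro smooth_on_mult smooth_on_const smooth_on_sum smooth_on_matrix_inv V smooth_on_hessian
        smooth_on_subset[OF GW VW] smooth_on_subset[OF f VW]) (auto simp: V_def)
  note SB = smooth_on_subset[OF SV BV] and LB = smooth_on_subset[OF L BW] and fB = smooth_on_subset[OF f BW]
  have fS: "f x = L x * S x" if "x \<in> B" for x
    using pde[OF that] n3 by (simp add: S_def n_def field_simps)
  have S0: "S (t *\<^sub>R x) = S x" if "x \<in> B" "t > 0" for x t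
    using fS[OF that(1)] fS[OF B(2)[OF that]] L2[OF that] f2[OF that] pos[OF that(1)] that(2) by simp
  have SB_eq: "(2 - n) * S x = L x * metric_trace L S x" if x: "x \<in> B" for x
  proof -
    have "(n + 2) * S x = metric_trace L f x" using n3 by (simp add: S_def)
    also have "\<dots> = metric_trace L (\<lambda>x. L x * S x) x" by (rule metric_trace_cong_open[OF B(1) x fS])
    also have "\<dots> = 2 * n * S x + L x * metric_trace L S x"
      unfolding n_def by (rule metric_trace_mult[OF B x LB L2 SB S0 lor[OF x]])
    finally show ?thesis by (simp add: algebra_simps)
  qed
  have bdS: "S x = 0" if x: "x \<in> closure B" "x \<noteq> 0" "x \<notin> B" for x
  proof -
    \<comment> \<open>The defect of the equation for \<open>S\<close> is continuous on \<open>V\<close> and zero on \<open>B\<close>, hence zero at \<open>x\<close>.\<close>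
    define D where "D x = (2 - n) * S x - L x * metric_trace L S x" for x
    have "smooth_on V D"
      unfolding D_def metric_trace_def
      by (intro smooth_on_mult smooth_on_diff smooth_on_const smooth_on_sum smooth_on_matrix_inv V smooth_on_hessian
        smooth_on_subset[OF GW VW] smooth_on_subset[OF L VW] SV) (auto simp: V_def)
    then have D: "isCont D x"
      using smooth_on_open_continuous V x clV continuous_on_eq_continuous_at by blast
    obtain u where u: "\<And>k. u k \<in> B" "u \<longlonglongrightarrow> x" using x(1) closure_sequential by blast
    have "(\<lambda>k. D (u k)) \<longlonglongrightarrow> D x" using isCont_tendsto_compose[OF D u(2)] .
    moreover have "D (u k) = 0" for k using SB_eq[OF u(1)] by (simp add: D_def)
    ultimately have "D x = 0" by (simp add: LIMSEQ_const_iff)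
    then show ?thesis using bd[OF x] n3 by (simp add: D_def)
  qed
  define K where "K = closure B \<inter> sphere 0 1"
  have unit: "(1 / norm x) *\<^sub>R x \<in> K \<inter> B \<and> S ((1 / norm x) *\<^sub>R x) = S x" if "x \<in> B" for x
  proof -
    have nx: "1 / norm x > 0" using that B0 by auto
    then show ?thesis using B(2)[OF that nx] S0[OF that nx] closure_subset[of B] by (auto simp: K_def)
  qed
  have "compact K" unfolding K_def by (rule closed_Int_compact) auto
  moreover have "K \<noteq> {}" using unit[OF y] by blast
  moreover have "K \<subseteq> V" using clV by (auto simp: K_def)
  then have "continuous_on K S" using smooth_on_open_continuous[OF SV] continuous_on_subset by blast
  ultimately obtain m where m: "m \<in> K" "\<And>x. x \<in> K \<Longrightarrow> S x \<le> S m"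
    using continuous_attains_sup[of K S] by blast
  have max: "S x \<le> S m" if "x \<in> B" for x using unit[OF that] m(2) by fastforce
  have "S y > 0" using fy fS[OF y] pos[OF y] by (simp add: zero_less_mult_iff not_le)
  then have Sm: "S m > 0" using max[OF y] by simp
  moreover have "m \<in> closure B" "m \<noteq> 0" using m(1) by (auto simp: K_def)
  ultimately have mB: "m \<in> B" using bdS[of m] by force
  have "L m * metric_trace L S m < 0"
    using SB_eq[OF mB] Sm n3 by (smt (verit) mult_neg_pos)
  moreover have "metric_trace L S m \<ge> 0"
    using metric_trace_nonneg_at_maximum[OF B mB LB L2 SB S0 lor[OF mB] pos[OF mB] max] .
  ultimately show False using pos[OF mB] by (simp add: mult_less_0_iff)
qed

lemma lorentzian_cone_vanish:
  fixes L f :: "real^'n \<Rightarrow> real"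
  assumes n: "CARD('n) \<ge> 3"
    and B: "open B" "\<And>x t. x \<in> B \<Longrightarrow> t > 0 \<Longrightarrow> t *\<^sub>R x \<in> B" and B0: "0 \<notin> B"
    and W: "open W" "closure B - {0} \<subseteq> W" and L: "smooth_on W L" and f: "smooth_on W f"
    and L2: "\<And>x t. x \<in> B \<Longrightarrow> t > 0 \<Longrightarrow> L (t *\<^sub>R x) = t\<^sup>2 * L x"
    and f2: "\<And>x t. x \<in> B \<Longrightarrow> t > 0 \<Longrightarrow> f (t *\<^sub>R x) = t\<^sup>2 * f x"
    and pos: "\<And>x. x \<in> B \<Longrightarrow> L x > 0"
    and lor: "\<And>x. x \<in> B \<Longrightarrow> lorentzian_matrix (half_hessian L x)"
    and bd: "\<And>x. x \<in> closure B \<Longrightarrow> x \<noteq> 0 \<Longrightarrow> x \<notin> B \<Longrightarrow> L x = 0 \<and> invertible (half_hessian L x)"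
    and pde: "\<And>x. x \<in> B \<Longrightarrow> (real CARD('n) + 2) * f x = L x * metric_trace L f x"
    and y: "y \<in> B"
  shows "f y = 0"
proof -
  have BW: "B \<subseteq> W" using W(2) B0 closure_subset[of B] by blast
  have "f y \<le> 0" by (rule lorentzian_cone_nonpos[OF n B B0 W L f L2 f2 pos lor bd pde y])
  moreover have "- 1 * f y \<le> 0"
  proof (rule lorentzian_cone_nonpos[OF n B B0 W L _ L2 _ pos lor bd _ y])
    show "smooth_on W (\<lambda>y. - 1 * f y)" by (intro smooth_on_mult smooth_on_const W f)
    show "- 1 * f (t *\<^sub>R x) = t\<^sup>2 * (- 1 * f x)" if "x \<in> B" "t > 0" for x t using f2[OF that] by simp
    show "(real CARD('n) + 2) * (- 1 * f x) = L x * metric_trace L (\<lambda>y. - 1 * f y) x" if "x \<in> B" for x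
      using pde[OF that] metric_trace_cmult[OF W(1) _ f, of x L "-1"] BW that by (simp add: subset_iff algebra_simps)
  qed
  ultimately show ?thesis by simp
qed

section \<open>Induced coordinates on the tangent bundle\<close>

lemma inv_coords:
  assumes "smooth_atlas M \<C>" "c \<in> \<C>" "z \<in> (snd c ` fst c) \<times> UNIV"
  shows "inv_into (over c (tangent_bundle M \<C>)) (coords c) z \<in> over c (tangent_bundle M \<C>)"
    and "coords c (inv_into (over c (tangent_bundle M \<C>)) (coords c) z) = z"
  using bij_betw_imp_surj_on[OF bij_betw_coords[OF assms(1,2)]] assms(3)
  by (auto intro: inv_into_into f_inv_into_f)

lemma inv_coords_coords:
  assumes "smooth_atlas M \<C>" "c \<in> \<C>" "v \<in> over c (tangent_bundle M \<C>)"
  shows "inv_into (over c (tangent_bundle M \<C>)) (coords c) (coords c v) = v"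
  using bij_betw_imp_inj_on[OF bij_betw_coords[OF assms(1,2)]] assms(3) by (rule inv_into_f_f)

lemma coord_rep_coords:
  assumes "smooth_atlas M \<C>" "c \<in> \<C>" "v \<in> over c (tangent_bundle M \<C>)"
  shows "coord_rep M \<C> c F (coords c v) = F v"
  using inv_coords_coords[OF assms] by (simp add: coord_rep_def)

lemma coords_transition:
  assumes at: "smooth_atlas M \<C>" and c: "c \<in> \<C>" and d: "d \<in> \<C>"
    and v: "v \<in> tangent_bundle M \<C>" and p: "fst v \<in> fst c" "fst v \<in> fst d"
  shows "coords d v = (transition c d (fst (coords c v)),
    frechet_derivative (transition c d) (at (fst (coords c v))) (snd (coords c v)))"
proof -
  have "is_chart M c" using at c by (simp add: smooth_atlas_def)
  moreover have "c \<in> charts_at \<C> (fst v)" "d \<in> charts_at \<C> (fst v)"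
    using c d p by (auto simp: charts_at_def)
  ultimately show ?thesis
    using v p transition_at[of M c "fst v" d] unfolding tangent_bundle_iff coords_def by fastforce
qed

text \<open>Joint continuity in the point and the vector follows by expanding the vector in the standard basis: each
  partial derivative of the transition map is continuous in the point.\<close>

lemma continuous_on_transition_tangent:
  assumes at: "smooth_atlas M \<C>" and c: "c \<in> \<C>" and d: "d \<in> \<C>"
  shows "continuous_on ((snd c ` (fst c \<inter> fst d)) \<times> UNIV)
    (\<lambda>z. (transition c d (fst z), frechet_derivative (transition c d) (at (fst z)) (snd z)))"
proof -
  define X where "X = snd c ` (fst c \<inter> fst d)"
  define \<tau> where "\<tau> = transition c d"
  have \<tau>: "smooth_on X \<tau>" using assms by (auto simp: smooth_atlas_def compatible_def X_def \<tau>_def)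
  have "continuous_on (X \<times> UNIV) (\<lambda>z. \<tau> (fst z))"
    by (rule continuous_on_compose2[OF smooth_on_open_continuous[OF \<tau>]]) (auto intro: continuous_intros)
  moreover have "continuous_on (X \<times> UNIV)
      (\<lambda>z. \<Sum>i\<in>UNIV. snd z $ i *\<^sub>R frechet_derivative \<tau> (at (fst z)) (axis i 1))"
    by (intro continuous_intros
        continuous_on_compose2[OF smooth_on_open_continuous[OF smooth_on_frechet_derivative[OF \<tau>]]]) auto
  moreover have "(\<Sum>i\<in>UNIV. snd z $ i *\<^sub>R frechet_derivative \<tau> (at (fst z)) (axis i 1)) =
      frechet_derivative \<tau> (at (fst z)) (snd z)" if "z \<in> X \<times> UNIV" for z
  proof -
    have lin: "linear (frechet_derivative \<tau> (at (fst z)))"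
      using smooth_on_differentiable[OF \<tau>] that by (auto intro: linear_frechet_derivative)
    have "frechet_derivative \<tau> (at (fst z)) (snd z) =
        frechet_derivative \<tau> (at (fst z)) (\<Sum>i\<in>UNIV. snd z $ i *\<^sub>R axis i 1)"
      using basis_expansion[of "snd z"] by (simp add: scalar_mult_eq_scaleR)
    then show ?thesis by (simp add: linear_sum[OF lin] linear_scale[OF lin])
  qed
  ultimately show ?thesis unfolding X_def[symmetric] \<tau>_def[symmetric]
    by (intro continuous_on_Pair) (auto cong: continuous_on_cong)
qed

text \<open>It suffices to test the subbasic open sets, given by some other chart \<open>d\<close>; their preimages are
  preimages of open sets under the change of coordinates from \<open>c\<close> to \<open>d\<close>.\<close>

lemma continuous_map_inv_coords:
  assumes at: "smooth_atlas M \<C>" and c: "c \<in> \<C>"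
  shows "continuous_map (top_of_set ((snd c ` fst c) \<times> UNIV)) (tangent_topology M \<C>)
    (inv_into (over c (tangent_bundle M \<C>)) (coords c))"
  unfolding tangent_topology_def
proof (rule continuous_on_generated_topo)
  define \<sigma> where "\<sigma> = inv_into (over c (tangent_bundle M \<C>)) (coords c)"
  define X where "X = (snd c ` fst c) \<times> (UNIV :: (real^'b) set)"
  note \<sigma> = inv_coords[OF at c, folded \<sigma>_def X_def]
  have ch: "is_chart M e" if "e \<in> \<C>" for e using at that by (simp add: smooth_atlas_def)
  let ?B = "{{v \<in> over c (tangent_bundle M \<C>). coords c v \<in> U} | c U. c \<in> \<C> \<and> open U}"
  have "{v \<in> over c (tangent_bundle M \<C>). coords c v \<in> UNIV} \<in> ?B" using c open_UNIV by blast
  then have "over c (tangent_bundle M \<C>) \<subseteq> \<Union>?B" by blast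
  then show "\<sigma> ` topspace (top_of_set X) \<subseteq> \<Union>?B" using \<sigma>(1) by auto
  fix T assume "T \<in> ?B"
  then obtain d U where d: "d \<in> \<C>" "open U" and T: "T = {v \<in> over d (tangent_bundle M \<C>). coords d v \<in> U}"
    by blast
  define Y where "Y = (snd c ` (fst c \<inter> fst d)) \<times> (UNIV :: (real^'b) set)"
  define F where "F z = (transition c d (fst z), frechet_derivative (transition c d) (at (fst z)) (snd z))" for z
  have YX: "Y \<subseteq> X" by (auto simp: X_def Y_def)
  have tb: "\<sigma> z \<in> tangent_bundle M \<C>" "fst (\<sigma> z) \<in> fst c" if "z \<in> X" for z
    using \<sigma>(1)[OF that] by (auto simp: over_def)
  have fz: "fst z = snd c (fst (\<sigma> z))" if "z \<in> X" for z
    using \<sigma>(2)[OF that] by (metis coords_def fst_conv)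
  have inY: "z \<in> Y \<longleftrightarrow> fst (\<sigma> z) \<in> fst d" if z: "z \<in> X" for z
  proof
    assume "z \<in> Y"
    then obtain q where q: "q \<in> fst c" "q \<in> fst d" "fst z = snd c q" by (auto simp: Y_def)
    then have "q = fst (\<sigma> z)" using chart_inj[OF ch[OF c]] fz[OF z] tb[OF z] by (auto dest: inj_onD)
    then show "fst (\<sigma> z) \<in> fst d" using q by simp
  next
    assume "fst (\<sigma> z) \<in> fst d"
    then show "z \<in> Y" using fz[OF z] tb[OF z] unfolding Y_def by (cases z) auto
  qed
  have F: "coords d (\<sigma> z) = F z" if "z \<in> Y" for z
  proof -
    have z: "z \<in> X" using that YX by blast
    show ?thesis
      using coords_transition[OF at c d(1) tb[OF z]] inY[OF z] that \<sigma>(2)[OF z] by (simp add: F_def)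
  qed
  have "\<sigma> -` T \<inter> topspace (top_of_set X) = {z \<in> X. fst (\<sigma> z) \<in> fst d \<and> coords d (\<sigma> z) \<in> U}"
    using tb by (auto simp: T over_def)
  also have "\<dots> = Y \<inter> F -` U" using inY F YX by auto
  finally have eq: "\<sigma> -` T \<inter> topspace (top_of_set X) = Y \<inter> F -` U" .
  have "openin M (fst d)" using ch[OF d(1)] by (simp add: is_chart_def)
  then have "open Y" unfolding Y_def by (intro open_Times chart_open_image[OF ch[OF c]] open_UNIV)
  then have "open (Y \<inter> F -` U)"
    using continuous_on_transition_tangent[OF at c d(1)] d(2) unfolding F_def[abs_def] Y_def
    by (intro continuous_open_preimage) auto
  then show "openin (top_of_set X) (\<sigma> -` T \<inter> topspace (top_of_set X))"
    unfolding eq using YX by (intro open_subset) auto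
qed

lemma open_preimage_inv_coords:
  assumes at: "smooth_atlas M \<C>" and c: "c \<in> \<C>" and T: "openin (tangent_topology M \<C>) T"
  shows "open {z \<in> (snd c ` fst c) \<times> UNIV. inv_into (over c (tangent_bundle M \<C>)) (coords c) z \<in> T}"
proof -
  have "is_chart M c" using at c by (simp add: smooth_atlas_def)
  then have "open ((snd c ` fst c) \<times> (UNIV :: (real^'b) set))"
    by (simp add: is_chart_def open_Times)
  then show ?thesis
    using openin_continuous_map_preimage[OF continuous_map_inv_coords[OF at c] T]
    by (simp add: openin_open_eq)
qed

lemma coord_set_eq_preimage:
  assumes at: "smooth_atlas M \<C>" and c: "c \<in> \<C>" and A: "A \<subseteq> tangent_bundle M \<C>"
  shows "coord_set c A = {z \<in> (snd c ` fst c) \<times> UNIV. inv_into (over c (tangent_bundle M \<C>)) (coords c) z \<in> A}"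
proof (intro set_eqI iffI)
  let ?\<sigma> = "inv_into (over c (tangent_bundle M \<C>)) (coords c)"
  fix z
  {
    assume "z \<in> coord_set c A"
    then obtain v where v: "v \<in> A" "fst v \<in> fst c" "z = coords c v" by (auto simp: coord_set_def over_def)
    moreover have "v \<in> over c (tangent_bundle M \<C>)" using v A by (auto simp: over_def)
    then have "?\<sigma> z = v" unfolding v(3) by (rule inv_coords_coords[OF at c])
    moreover have "z \<in> (snd c ` fst c) \<times> UNIV" using v by (simp add: coords_def)
    ultimately show "z \<in> {z \<in> (snd c ` fst c) \<times> UNIV. ?\<sigma> z \<in> A}" by simp
  next
    assume "z \<in> {z \<in> (snd c ` fst c) \<times> UNIV. ?\<sigma> z \<in> A}"
    then have z: "z \<in> (snd c ` fst c) \<times> UNIV" "?\<sigma> z \<in> A" by auto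
    have "?\<sigma> z \<in> over c A" using inv_coords(1)[OF at c z(1)] z(2) by (simp add: over_def)
    then show "z \<in> coord_set c A"
      unfolding coord_set_def using inv_coords(2)[OF at c z(1)] by (metis imageI)
  }
qed

lemma open_coord_set:
  assumes at: "smooth_atlas M \<C>" and c: "c \<in> \<C>" and A: "openin (tangent_topology M \<C>) A"
  shows "open (coord_set c A)"
proof -
  have "A \<subseteq> tangent_bundle M \<C>" using openin_subset[OF A] topspace_tangent_topology[OF at] by simp
  then show ?thesis using open_preimage_inv_coords[OF at c A] coord_set_eq_preimage[OF at c] by simp
qed

text \<open>A coordinate limit of points of \<open>A\<close> with nonzero fibre part is a limit
  in the tangent bundle, because the inverse of the induced chart is continuous.\<close>

lemma closure_coord_set_in_slit_closure:
  assumes at: "smooth_atlas M \<C>" and c: "c \<in> \<C>" and A: "A \<subseteq> slit_bundle M \<C>"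
    and z: "z \<in> closure (coord_set c A)" "fst z \<in> snd c ` fst c" "snd z \<noteq> 0"
  shows "z \<in> coord_set c (slit_closure M \<C> A)"
proof -
  define \<sigma> where "\<sigma> = inv_into (over c (tangent_bundle M \<C>)) (coords c)"
  have zX: "z \<in> (snd c ` fst c) \<times> UNIV" using z(2) by (cases z) auto
  note \<sigma>z = inv_coords[OF at c zX, folded \<sigma>_def]
  have AT: "A \<subseteq> tangent_bundle M \<C>" using A by (auto simp: slit_bundle_def)
  have "snd (\<sigma> z) c \<noteq> 0" using \<sigma>z(2) z(3) by (metis coords_def snd_conv)
  then have slit: "\<sigma> z \<in> slit_bundle M \<C>" using \<sigma>z(1) by (auto simp: slit_bundle_def over_def)
  have "\<sigma> z \<in> slit_closure M \<C> A"
    unfolding slit_closure_def in_closure_of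
  proof (intro conjI allI impI)
    show "\<sigma> z \<in> topspace (subtopology (tangent_topology M \<C>) (slit_bundle M \<C>))"
      using slit topspace_tangent_topology[OF at] by (auto simp: slit_bundle_def)
    fix T assume "\<sigma> z \<in> T \<and> openin (subtopology (tangent_topology M \<C>) (slit_bundle M \<C>)) T"
    then obtain T' where T': "openin (tangent_topology M \<C>) T'" "T = T' \<inter> slit_bundle M \<C>" "\<sigma> z \<in> T'"
      by (auto simp: openin_subtopology)
    define O' where "O' = {z \<in> (snd c ` fst c) \<times> UNIV. \<sigma> z \<in> T'}"
    have "open O'" unfolding O'_def \<sigma>_def by (rule open_preimage_inv_coords[OF at c T'(1)])
    moreover have "z \<in> O'" using zX T' by (simp add: O'_def)
    ultimately obtain z' where "z' \<in> coord_set c A" "z' \<in> O'"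
      using z(1) by (meson closure_iff_nhds_not_empty disjoint_iff subset_refl)
    then have "\<sigma> z' \<in> A" "\<sigma> z' \<in> T'"
      using coord_set_eq_preimage[OF at c AT, folded \<sigma>_def] by (simp_all add: O'_def)
    then show "\<exists>y. y \<in> A \<and> y \<in> T" using A T' by blast
  qed
  moreover have "\<sigma> z \<in> over c (tangent_bundle M \<C>)" by (rule \<sigma>z(1))
  ultimately show ?thesis using \<sigma>z(2) unfolding coord_set_def over_def by force
qed

lemma coord_set_conic:
  assumes "\<And>v t. v \<in> A \<Longrightarrow> t > 0 \<Longrightarrow> tscale t v \<in> A" "(x, y) \<in> coord_set c A" "t > 0"
  shows "(x, t *\<^sub>R y) \<in> coord_set c A"
proof -
  obtain v where v: "v \<in> over c A" "coords c v = (x, y)" using assms(2) by (auto simp: coord_set_def)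
  then have "tscale t v \<in> over c A" "coords c (tscale t v) = (x, t *\<^sub>R y)"
    using assms(1,3) by (auto simp: over_def tscale_def coords_def)
  then show ?thesis unfolding coord_set_def by force
qed

text \<open>A vector with zero components in one chart has zero components in all charts, hence is excluded from the slit
  bundle.\<close>

lemma coord_set_slit_nonzero:
  assumes at: "smooth_atlas M \<C>" and c: "c \<in> \<C>" and A: "A \<subseteq> slit_bundle M \<C>"
  shows "(x, 0) \<notin> coord_set c A"
proof
  assume "(x, 0) \<in> coord_set c A"
  then obtain v where v: "v \<in> A" "fst v \<in> fst c" "snd v c = 0"
    by (auto simp: coord_set_def over_def coords_def)
  have cc: "c \<in> charts_at \<C> (fst v)" using c v by (simp add: charts_at_def)
  have vt: "v \<in> tangent_bundle M \<C>" "snd v \<noteq> (\<lambda>_. 0)" using A v by (auto simp: slit_bundle_def)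
  have "snd v d = 0" for d
  proof (cases "d \<in> charts_at \<C> (fst v)")
    case True
    then have "snd v d = frechet_derivative (transition c d) (at (snd c (fst v))) 0"
      using vt(1) cc v(3) unfolding tangent_bundle_iff by metis
    then show ?thesis
      using linear_frechet_derivative[OF transition_differentiable[OF at cc True]] by (simp add: linear_0)
  next
    case False
    then show ?thesis using vt(1) unfolding tangent_bundle_iff by blast
  qed
  then show False using vt(2) by auto
qed

lemma dx_cong_open:
  "open S \<Longrightarrow> z \<in> S \<Longrightarrow> (\<And>y. y \<in> S \<Longrightarrow> f y = g y) \<Longrightarrow> dx a f z = dx a g z"
  unfolding dx_def using frechet_derivative_cong_open[of S z f g] by simp

lemma dy_cong_open:
  "open S \<Longrightarrow> z \<in> S \<Longrightarrow> (\<And>y. y \<in> S \<Longrightarrow> f y = g y) \<Longrightarrow> dy a f z = dy a g z"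
  unfolding dy_def using frechet_derivative_cong_open[of S z f g] by simp

lemma dy_dy_cong_open:
  assumes "open S" "z \<in> S" "\<And>y. y \<in> S \<Longrightarrow> f y = g y"
  shows "dy b (dy a f) z = dy b (dy a g) z"
  by (intro dy_cong_open[OF assms(1,2)] dy_cong_open[OF assms(1) _ assms(3)])

lemma fundamental_tensor_cong_open:
  assumes "open S" "z \<in> S" "\<And>y. y \<in> S \<Longrightarrow> f y = g y"
  shows "fundamental_tensor f z = fundamental_tensor g z"
  unfolding fundamental_tensor_def using dy_dy_cong_open[OF assms] by simp

lemma dy_fibre:
  assumes "f differentiable (at (x, y))"
  shows "pderiv_at a (\<lambda>y. f (x, y)) y = dy a f (x, y)"
proof -
  have "((\<lambda>y. (x, y)) has_derivative (\<lambda>v. (0, v))) (at y)" by (auto intro!: derivative_eq_intros)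
  then have "((\<lambda>y. f (x, y)) has_derivative (\<lambda>v. frechet_derivative f (at (x, y)) (0, v))) (at y)"
    using has_derivative_compose[of "\<lambda>y. (x, y)" _ y UNIV f "frechet_derivative f (at (x, y))"] assms
    by (simp add: frechet_derivative_works)
  then show ?thesis unfolding pderiv_at_def dy_def by (simp add: frechet_derivative_at[symmetric])
qed

lemma hessian_fibre:
  assumes W: "open W" "(x, y) \<in> W" and f: "smooth_on W f"
  shows "hessian (\<lambda>y. f (x, y)) y $ a $ b = dy b (dy a f) (x, y)"
proof -
  have "pderiv_at b (pderiv_at a (\<lambda>y. f (x, y))) y = pderiv_at b (\<lambda>y. dy a f (x, y)) y"
    by (rule pderiv_at_cong_open[OF open_Collect_Pair[OF W(1), of x]])
      (use W in \<open>auto intro!: dy_fibre smooth_on_differentiable[OF f]\<close>)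
  also have "\<dots> = dy b (dy a f) (x, y)"
    by (intro dy_fibre smooth_on_differentiable[OF smooth_on_dy[OF f]] W)
  finally show ?thesis by (simp add: hessian_def)
qed

lemma half_hessian_fibre:
  assumes W: "open W" "(x, y) \<in> W" and f: "smooth_on W f"
  shows "half_hessian (\<lambda>y. f (x, y)) y = fundamental_tensor f (x, y)"
  unfolding half_hessian_def fundamental_tensor_def hessian_fibre[OF assms] ..

lemma ricci_cong_open:
  assumes "open S" "z \<in> S" "\<And>k i z. z \<in> S \<Longrightarrow> N c k i z = N' c k i z"
  shows "ricci N c z = ricci N' c z"
  unfolding ricci_def curvature_def delta_def
  using dx_cong_open[OF assms(1,2), of "N c k i" "N' c k i" for k i]
    dy_cong_open[OF assms(1,2), of "N c k i" "N' c k i" for k i] assms by simp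

lemma smooth_on_ricci:
  fixes N :: "('m, 'n::finite) connection"
  assumes W: "open W" and N: "\<And>k i. smooth_on W (N c k i)"
  shows "smooth_on W (ricci N c)"
proof -
  have "bounded_linear (\<lambda>z::(real^'n) \<times> (real^'n). snd z $ b)" for b
    by (rule bounded_linear_compose[OF bounded_linear_vec_nth bounded_linear_snd])
  then have "smooth_on W (\<lambda>z::(real^'n) \<times> (real^'n). snd z $ b)" for b
    by (rule smooth_on_bounded_linear[OF W])
  then have "smooth_on W (\<lambda>z. \<Sum>b\<in>UNIV. \<Sum>a\<in>UNIV. snd z $ b * curvature N c a b a z)"
    unfolding curvature_def delta_def
    by (intro smooth_on_sum smooth_on_mult smooth_on_diff W smooth_on_dx smooth_on_dy N finite)
  then show ?thesis by (simp add: ricci_def[abs_def])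
qed

text \<open>Derivatives in \<open>x\<close> preserve the degree and derivatives in \<open>y\<close> lower it by one, so the curvature has degree \<open>1\<close>,
  and contraction with \<open>y\<close> raises it to \<open>2\<close>.\<close>

lemma ricci_homogeneous:
  fixes N :: "('m, 'n::finite) connection"
  assumes U: "open U" "\<And>x y t. (x, y) \<in> U \<Longrightarrow> t > 0 \<Longrightarrow> (x, t *\<^sub>R y) \<in> U"
    and N: "\<And>k i. smooth_on U (N c k i)"
    and hom: "\<And>k i x y t. (x, y) \<in> U \<Longrightarrow> t > 0 \<Longrightarrow> N c k i (x, t *\<^sub>R y) = t * N c k i (x, y)"
    and xy: "(x, y) \<in> U" and t: "t > 0"
  shows "ricci N c (x, t *\<^sub>R y) = t\<^sup>2 * ricci N c (x, y)"
proof -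
  have T: "bounded_linear (\<lambda>z::(real^'n) \<times> (real^'n). (fst z, t *\<^sub>R snd z))"
    by (intro bounded_linear_Pair bounded_linear_fst bounded_linear_compose[OF bounded_linear_scaleR_right bounded_linear_snd])
  have xty: "(x, t *\<^sub>R y) \<in> U" using U(2)[OF xy t] .
  have D: "frechet_derivative (N c k i) (at (x, t *\<^sub>R y)) (u, t *\<^sub>R v) =
      t * frechet_derivative (N c k i) (at (x, y)) (u, v)" for k i u v
    using frechet_derivative_homogeneous[OF U(1) xy T, of "N c k i" t "(u, v)"] hom[OF _ t]
      smooth_on_differentiable[OF N xy] smooth_on_differentiable[OF N xty] by auto
  have dx: "dx j (N c k i) (x, t *\<^sub>R y) = t * dx j (N c k i) (x, y)" for j k i
    using D[of k i "axis j 1" 0] by (simp add: dx_def)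
  have dy: "dy j (N c k i) (x, t *\<^sub>R y) = dy j (N c k i) (x, y)" for j k i
  proof -
    have "linear (frechet_derivative (N c k i) (at (x, t *\<^sub>R y)))"
      using smooth_on_differentiable[OF N xty] by (rule linear_frechet_derivative)
    then have "frechet_derivative (N c k i) (at (x, t *\<^sub>R y)) (0, t *\<^sub>R axis j 1) = t * dy j (N c k i) (x, t *\<^sub>R y)"
      using linear_scale[of _ t "(0, axis j 1)"] by (fastforce simp: dy_def)
    then show ?thesis using D[of k i 0 "axis j 1"] t by (simp add: dy_def)
  qed
  have "delta N c j (N c k i) (x, t *\<^sub>R y) = t * delta N c j (N c k i) (x, y)" for j k i
    unfolding delta_def dx dy hom[OF xy t] by (simp add: right_diff_distrib sum_distrib_left mult.assoc)
  then have "curvature N c k i j (x, t *\<^sub>R y) = t * curvature N c k i j (x, y)" for k i j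
    by (simp add: curvature_def right_diff_distrib)
  then show ?thesis by (simp add: ricci_def sum_distrib_left power2_eq_square mult_ac)
qed

section \<open>Vanishing of the Ricci scalar\<close>

theorem theoremC:
  fixes M :: "'m topology"
    and \<C> :: "('m, 'n::finite) chart set"
    and A :: "('m, 'n) tvec set"
    and L :: "('m, 'n) tvec \<Rightarrow> real"
    and N :: "('m, 'n) connection"
  assumes "smooth_manifold M \<C>" and "connected_space M"
    and "CARD('n) \<ge> 3"
    and "conic_domain M \<C> A"
    and "lorentz_finsler M \<C> A L"
    and "nonlinear_connection M \<C> A N"
    and "connection_extends_smoothly M \<C> A N"
    and "\<And>c z. c \<in> \<C> \<Longrightarrow> z \<in> coord_set c A \<Longrightarrow>
      (real CARD('n) + 2) * ricci N c z
        - coord_rep M \<C> c L z *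
          (\<Sum>a\<in>UNIV. \<Sum>b\<in>UNIV.
            matrix_inv (fundamental_tensor (coord_rep M \<C> c L) z) $ a $ b
              * dy b (dy a (ricci N c)) z) = 0"
  shows "\<forall>c\<in>\<C>. \<forall>z\<in>coord_set c A. ricci N c z = 0"
proof (intro ballI)
  fix c z0 assume c: "c \<in> \<C>" and z0: "z0 \<in> coord_set c A"
  have at: "smooth_atlas M \<C>" using assms(1) by (simp add: smooth_manifold_def)
  note lf = assms(5)[unfolded lorentz_finsler_def]
  have pf: "pseudo_finsler M \<C> A L" and pm: "proper_metric M \<C> A L" using lf by simp_all
  have slit: "A \<subseteq> slit_bundle M \<C>" and opA: "openin (tangent_topology M \<C>) A"
    and conic: "\<And>v t. v \<in> A \<Longrightarrow> t > 0 \<Longrightarrow> tscale t v \<in> A"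
    using assms(4) by (simp_all add: conic_domain_def)
  define U where "U = coord_set c A"
  have U: "open U" unfolding U_def by (rule open_coord_set[OF at c opA])
  have Uconic: "(x, t *\<^sub>R y) \<in> U" if "(x, y) \<in> U" "t > 0" for x y t
    using coord_set_conic[OF conic] that unfolding U_def by blast
  have rep: "coord_rep M \<C> c L (coords c v) = L v" if "v \<in> over c A" for v
    using that slit by (intro coord_rep_coords[OF at c]) (auto simp: over_def slit_bundle_def)

  obtain h where "smooth_extension M \<C> A c (coord_rep M \<C> c L) h"
    and hbd: "\<And>z. z \<in> coord_set c (slit_boundary M \<C> A) \<Longrightarrow> h z = 0 \<and> invertible (fundamental_tensor h z)"
    using pm c unfolding proper_metric_def by blast
  then obtain Wh where Wh: "open Wh" "coord_set c (slit_closure M \<C> A) \<subseteq> Wh" "smooth_on Wh h"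
    and hL: "\<And>z. z \<in> U \<Longrightarrow> h z = coord_rep M \<C> c L z"
    unfolding smooth_extension_def U_def by blast
  have "\<forall>k i. \<exists>h. smooth_extension M \<C> A c (N c k i) h"
    using assms(7) c by (simp add: connection_extends_smoothly_def)
  then obtain H where H: "\<And>k i. smooth_extension M \<C> A c (N c k i) (H k i)" by metis
  then have "\<forall>k i. \<exists>W. open W \<and> coord_set c (slit_closure M \<C> A) \<subseteq> W \<and> smooth_on W (H k i)"
    unfolding smooth_extension_def by blast
  then obtain WN where WN: "\<And>k i. open (WN k i)" "\<And>k i. coord_set c (slit_closure M \<C> A) \<subseteq> WN k i"
      "\<And>k i. smooth_on (WN k i) (H k i)"
    by metis
  have HN: "H k i z = N c k i z" if "z \<in> U" for k i z
    using H that unfolding smooth_extension_def U_def by blast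
  define W where "W = Wh \<inter> (\<Inter>k. \<Inter>i. WN k i)"
  have W: "open W" unfolding W_def by (intro open_Int open_INT ballI finite Wh WN)
  have clW: "coord_set c (slit_closure M \<C> A) \<subseteq> W" using Wh WN unfolding W_def by blast
  have hW: "smooth_on W h" using smooth_on_subset[OF Wh(3)] by (simp add: W_def)
  have HW: "smooth_on W (H k i)" for k i
    by (rule smooth_on_subset[OF WN(3)]) (auto simp: W_def)

  \<comment> \<open>The Ricci scalar of the extended components is the smooth extension of the Ricci scalar; only the chart \<open>c\<close>
    matters.\<close>
  define N' :: "('m, 'n) connection" where "N' = (\<lambda>_. H)"
  have RW: "smooth_on W (ricci N' c)" by (rule smooth_on_ricci[OF W]) (simp add: N'_def HW)
  have RN: "ricci N c z = ricci N' c z" if "z \<in> U" for z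
    by (rule ricci_cong_open[OF U that]) (simp add: N'_def HN)

  obtain x y0 where xy0: "z0 = (x, y0)" by (cases z0)
  define B where "B = {y. (x, y) \<in> U}"
  define V where "V = {y. (x, y) \<in> W}"
  have B: "open B" unfolding B_def by (rule open_Collect_Pair[OF U])
  have V: "open V" unfolding V_def by (rule open_Collect_Pair[OF W])
  have x: "x \<in> snd c ` fst c" using z0 by (auto simp: xy0 coord_set_def over_def coords_def)
  have closB: "(x, y) \<in> coord_set c (slit_closure M \<C> A)" if y: "y \<in> closure B" "y \<noteq> 0" for y
  proof -
    have "Pair x ` closure B \<subseteq> closure U"
      by (rule image_closure_subset)
        (auto simp: B_def intro!: continuous_intros closure_subset[THEN subsetD])
    then have "(x, y) \<in> closure U" using y by blast
    then show ?thesis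
      using closure_coord_set_in_slit_closure[OF at c slit] x y(2) by (simp add: U_def)
  qed
  have UW: "z \<in> W" if "z \<in> U" for z
  proof -
    obtain u v where z: "z = (u, v)" by (cases z)
    have "z \<in> closure (coord_set c A)" using that closure_subset unfolding U_def by blast
    moreover have "u \<in> snd c ` fst c" using that by (auto simp: z U_def coord_set_def over_def coords_def)
    moreover have "v \<noteq> 0" using coord_set_slit_nonzero[OF at c slit] that by (auto simp: z U_def)
    ultimately show ?thesis
      using closure_coord_set_in_slit_closure[OF at c slit, of z] clW by (auto simp: z)
  qed
  have ft: "half_hessian (\<lambda>y. h (x, y)) y = fundamental_tensor h (x, y)" if "(x, y) \<in> W" for y
    by (rule half_hessian_fibre[OF W that hW])
  have ftL: "fundamental_tensor h z = fundamental_tensor (coord_rep M \<C> c L) z" if "z \<in> U" for z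
    by (rule fundamental_tensor_cong_open[OF U that hL])

  have "ricci N' c (x, y0) = 0"
  proof (rule lorentzian_cone_vanish[where B = B and W = V and L = "\<lambda>y. h (x, y)"])
    show "CARD('n) \<ge> 3" by (rule assms(3))
    show "open B" "open V" by (rule B, rule V)
    show "t *\<^sub>R y \<in> B" if "y \<in> B" "t > 0" for y t using Uconic that by (simp add: B_def)
    show "0 \<notin> B" using coord_set_slit_nonzero[OF at c slit] by (simp add: B_def U_def)
    show "closure B - {0} \<subseteq> V" using closB clW by (auto simp: V_def)
    show "smooth_on V (\<lambda>y. h (x, y))" unfolding V_def by (rule smooth_on_fibre[OF W hW])
    show "smooth_on V (\<lambda>y. ricci N' c (x, y))" unfolding V_def by (rule smooth_on_fibre[OF W RW])
    show "h (x, t *\<^sub>R y) = t\<^sup>2 * h (x, y)" if y: "y \<in> B" "t > 0" for y t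
    proof -
      obtain v where v: "v \<in> over c A" "(x, y) = coords c v"
        using y by (auto simp: B_def U_def coord_set_def)
      then have tv: "tscale t v \<in> over c A" "(x, t *\<^sub>R y) = coords c (tscale t v)"
        using conic y by (auto simp: over_def tscale_def coords_def)
      have U2: "(x, y) \<in> U" "(x, t *\<^sub>R y) \<in> U" using y Uconic by (auto simp: B_def)
      have "h (x, t *\<^sub>R y) = L (tscale t v)" using hL[OF U2(2)] rep[OF tv(1)] tv(2) by simp
      also have "\<dots> = t\<^sup>2 * L v" using pf v y by (simp add: pseudo_finsler_def over_def)
      also have "L v = h (x, y)" using hL[OF U2(1)] rep[OF v(1)] v(2) by simp
      finally show ?thesis .
    qed
    show "ricci N' c (x, t *\<^sub>R y) = t\<^sup>2 * ricci N' c (x, y)" if y: "y \<in> B" "t > 0" for y t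
    proof (rule ricci_homogeneous[OF U Uconic _ _ _ y(2)])
      show "smooth_on U (N' c k i)" for k i
        unfolding N'_def by (rule smooth_on_subset[OF HW]) (use UW in blast)
      show "N' c k i (x, t *\<^sub>R y) = t * N' c k i (x, y)" if "(x, y) \<in> U" "t > 0" for k i x y t
      proof -
        have "N c k i (x, t *\<^sub>R y) = t * N c k i (x, y)"
          using assms(6) c that unfolding nonlinear_connection_def U_def by fastforce
        then show ?thesis using HN[OF that(1)] HN[OF Uconic[OF that]] by (simp add: N'_def)
      qed
      show "(x, y) \<in> U" using y by (simp add: B_def)
    qed
    show "h (x, y) > 0" if y: "y \<in> B" for y
    proof -
      obtain v where v: "v \<in> over c A" "(x, y) = coords c v"
        using y by (auto simp: B_def U_def coord_set_def)
      then show ?thesis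
        using hL[of "(x, y)"] rep[OF v(1)] pm y by (auto simp: B_def over_def proper_metric_def)
    qed
    show "lorentzian_matrix (half_hessian (\<lambda>y. h (x, y)) y)" if "y \<in> B" for y
      using that lf c ft[OF UW] ftL by (simp add: B_def U_def)
    show "h (x, y) = 0 \<and> invertible (half_hessian (\<lambda>y. h (x, y)) y)"
      if y: "y \<in> closure B" "y \<noteq> 0" "y \<notin> B" for y
    proof -
      obtain v where v: "v \<in> over c (slit_closure M \<C> A)" "coords c v = (x, y)"
        using closB[OF y(1,2)] by (auto simp: coord_set_def)
      have "v \<notin> A"
      proof
        assume "v \<in> A"
        then have "coords c v \<in> coord_set c A" using v(1) by (auto simp: coord_set_def over_def)
        then show False using y(3) v(2) by (simp add: B_def U_def)
      qed
      then have "v \<in> over c (slit_boundary M \<C> A)" using v(1) by (simp add: over_def slit_boundary_def)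
      then have "(x, y) \<in> coord_set c (slit_boundary M \<C> A)"
        unfolding coord_set_def v(2)[symmetric] by (rule imageI)
      moreover have "(x, y) \<in> W" using closB[OF y(1,2)] clW by blast
      ultimately show ?thesis using hbd ft by simp
    qed
    show "(real CARD('n) + 2) * ricci N' c (x, y) =
        h (x, y) * metric_trace (\<lambda>y. h (x, y)) (\<lambda>y. ricci N' c (x, y)) y" if "y \<in> B" for y
    proof -
      have xyU: "(x, y) \<in> U" using that by (simp add: B_def)
      then have "dy b (dy a (ricci N c)) (x, y) = hessian (\<lambda>y. ricci N' c (x, y)) y $ a $ b" for a b
        using hessian_fibre[OF W UW[OF xyU] RW] dy_dy_cong_open[OF U xyU RN] by simp
      then show ?thesis
        using assms(8)[OF c, of "(x, y)"] xyU hL[OF xyU] RN[OF xyU] ft[OF UW[OF xyU]] ftL[OF xyU]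
        by (simp add: U_def metric_trace_def)
    qed
    show "y0 \<in> B" using z0 by (simp add: B_def U_def xy0)
  qed
  then show "ricci N c z0 = 0" using RN[of z0] z0 by (simp add: U_def xy0)
qed

end
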